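(* Let $\sigma$ be a finite relational signature and let $(\mathbf{S},\mathbf{T})$ be a PCSP template of signature $\sigma$ (so $\mathbf{S}\to\mathbf{T}$) with domains $S$ and $T$. Suppose that $(\mathbf{S},\mathbf{T})$ has sublinear width. If for all $U,V\in\mathscr{G}(\mathbf{S})$ we have $U\circ V=S^2$, then $\mathbf{T}$ is reflexive, i.e., there exists $a\in T$ such that for every $R\in\sigma$ (of arity $r$) the reflexive tuple $(a,a,\dots,a)$ belongs to $R^{\mathbf{T}}$. In particular, this conclusion holds if $(\mathbf{S},\mathbf{T})$ has bounded width.
   Context: All signatures and structures are finite. A $\sigma$-structure $\mathbf{A}$ has a domain $A$ and a relation $R^{\mathbf{A}}\subseteq A^r$ for each symbol $R\in\sigma$ of arity $r$. A homomorphism $\mathbf{A}\to\mathbf{B}$ is a map $f:A\to B$ with $f(\mathbf{a})\in R^{\mathbf{B}}$ (applied coordinatewise) for all $R\in\sigma$ and $\mathbf{a}\in R^{\mathbf{A}}$; $\mathbf{A}\to\mathbf{B}$ denotes that one exists. A PCSP template is a pair $(\mathbf{S},\mathbf{T})$ of $\sigma$-structures with $\mathbf{S}\to\mathbf{T}$. For $X\subseteq I$, $\mathbf{I}|_X$ is the induced substructure on $X$; a partial homomorphism from $\mathbf{I}$ to $\mathbf{S}$ is a map $f:X\to S$, $X\subseteq I$, that is a homomorphism from $\mathbf{I}|_X$ to $\mathbf{S}$. A $k$-strategy on $\mathbf{I}$ and $\mathbf{S}$ is a nonempty collection $\mathscr{H}$ of partial homomorphisms from $\mathbf{I}$ to $\mathbf{S}$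 that is closed under restrictions (if $h\in\mathscr{H}$ and $X\subseteq\mathrm{dom}(h)$ then $h|_X\in\mathscr{H}$) and has the extension property up to $k$ (for every $h\in\mathscr{H}$ with $|\mathrm{dom}(h)|<k$ and every $x\in I\setminus\mathrm{dom}(h)$ there is $f\in\mathscr{H}$ extending $h$ with $\mathrm{dom}(f)=\mathrm{dom}(h)\cup\{x\}$). Write $\mathbf{I}\le_k\mathbf{S}$ if a $k$-strategy on $\mathbf{I}$ and $\mathbf{S}$ exists. For an integer function $k(n)$, the template $(\mathbf{S},\mathbf{T})$ has width $k(n)$ if for every $\sigma$-structure $\mathbf{I}$ with $n$ elements, $\mathbf{I}\le_{k(n)}\mathbf{S}$ implies $\mathbf{I}\to\mathbf{T}$. It has bounded width if it has width $k(n)$ for some $k(n)=O(1)$, and sublinear width if it has width $k(n)$ for some $k(n)=o(n)$. For a relation $R\subseteq A^r$ and $i,j\in[r]$, $\mathrm{pr}_{i,j}R=\{(\mathbf{a}(i),\mathbf{a}(j))\mid \mathbf{a}\in R\}$; $\mathscr{G}(R)=\{\mathrm{pr}_{i,j}R\mid i,j\in[r],\ i\ne j\}$; and $\mathscr{G}(\mathbf{A})=\mathscr{G}(\prod_{R\in\sigma}R^{\mathbf{A}})$, where $\prod$ denotes the product (concatenation) of relations. For binary relations, $U\circ V=\{(a,b)\mid \exists c\,((a,c)\in U,\ (c,b)\in V)\}$.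
   Formalization: Domains are nonempty, and every relation of S is assumed nonempty; this follows from U∘V=S² unless the total arity is at most 1, where the claim fails (one unary symbol, empty in both S and T). *)

theory Defs
  imports Complex_Main "HOL-Library.FuncSet" "HOL-Library.Landau_Symbols"
begin

record 'r signature =
  syms :: "'r set"
  arity :: "'r \<Rightarrow> nat"

record ('r, 'a) rel_structure =
  univ :: "'a set"
  rel :: "'r \<Rightarrow> 'a list set"

text \<open>Structures are finite and, as usual, have a nonempty domain. The value of \<open>rel\<close> at
  symbols outside the signature is irrelevant.\<close>

definition is_structure :: "'r signature \<Rightarrow> ('r, 'a) rel_structure \<Rightarrow> bool" where
  "is_structure \<sigma> A \<longleftrightarrow> finite (univ A) \<and> univ A \<noteq> {} \<and>
     (\<forall>R\<in>syms \<sigma>. rel A R \<subseteq> {a. length a = arity \<sigma> R \<and> set a \<subseteq> univ A})"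

definition homomorphism ::
  "'r signature \<Rightarrow> ('r, 'a) rel_structure \<Rightarrow> ('r, 'b) rel_structure \<Rightarrow> ('a \<Rightarrow> 'b) \<Rightarrow> bool" where
  "homomorphism \<sigma> A B f \<longleftrightarrow> f \<in> univ A \<rightarrow> univ B \<and>
     (\<forall>R\<in>syms \<sigma>. \<forall>a\<in>rel A R. map f a \<in> rel B R)"

definition maps_to ::
  "'r signature \<Rightarrow> ('r, 'a) rel_structure \<Rightarrow> ('r, 'b) rel_structure \<Rightarrow> bool" where
  "maps_to \<sigma> A B \<longleftrightarrow> (\<exists>f. homomorphism \<sigma> A B f)"

definition pcsp_template ::
  "'r signature \<Rightarrow> ('r, 's) rel_structure \<Rightarrow> ('r, 't) rel_structure \<Rightarrow> bool" where
  "pcsp_template \<sigma> S T \<longleftrightarrow> is_structure \<sigma> S \<and> is_structure \<sigma> T \<and> maps_to \<sigma> S T"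

definition induced :: "('r, 'a) rel_structure \<Rightarrow> 'a set \<Rightarrow> ('r, 'a) rel_structure" where
  "induced A X = \<lparr>univ = X, rel = (\<lambda>R. {a \<in> rel A R. set a \<subseteq> X})\<rparr>"

definition partial_hom ::
  "'r signature \<Rightarrow> ('r, 'a) rel_structure \<Rightarrow> ('r, 's) rel_structure \<Rightarrow> ('a \<rightharpoonup> 's) \<Rightarrow> bool" where
  "partial_hom \<sigma> I S h \<longleftrightarrow>
     dom h \<subseteq> univ I \<and> homomorphism \<sigma> (induced I (dom h)) S (the \<circ> h)"

definition strategy ::
  "'r signature \<Rightarrow> nat \<Rightarrow> ('r, 'a) rel_structure \<Rightarrow> ('r, 's) rel_structure \<Rightarrow>
     ('a \<rightharpoonup> 's) set \<Rightarrow> bool" where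
  "strategy \<sigma> k I S H \<longleftrightarrow>
     H \<noteq> {} \<and>
     (\<forall>h\<in>H. partial_hom \<sigma> I S h) \<and>
     (\<forall>h\<in>H. \<forall>X. X \<subseteq> dom h \<longrightarrow> h |` X \<in> H) \<and>
     (\<forall>h\<in>H. card (dom h) < k \<longrightarrow>
        (\<forall>x\<in>univ I - dom h. \<exists>f\<in>H. h \<subseteq>\<^sub>m f \<and> dom f = dom h \<union> {x}))"

definition strategy_le ::
  "'r signature \<Rightarrow> nat \<Rightarrow> ('r, 'a) rel_structure \<Rightarrow> ('r, 's) rel_structure \<Rightarrow> bool" where
  "strategy_le \<sigma> k I S \<longleftrightarrow> (\<exists>H. strategy \<sigma> k I S H)"

text \<open>Instances range over all structures whose domain is a finite set of natural numbers. Up to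
  isomorphism these are all finite structures, and the condition is invariant under isomorphism
  of the instance.\<close>

definition has_width ::
  "'r signature \<Rightarrow> ('r, 's) rel_structure \<Rightarrow> ('r, 't) rel_structure \<Rightarrow> (nat \<Rightarrow> nat) \<Rightarrow> bool" where
  "has_width \<sigma> S T k \<longleftrightarrow>
     (\<forall>I :: ('r, nat) rel_structure. is_structure \<sigma> I \<longrightarrow>
        strategy_le \<sigma> (k (card (univ I))) I S \<longrightarrow> maps_to \<sigma> I T)"

definition bounded_width ::
  "'r signature \<Rightarrow> ('r, 's) rel_structure \<Rightarrow> ('r, 't) rel_structure \<Rightarrow> bool" where
  "bounded_width \<sigma> S T \<longleftrightarrow>
     (\<exists>k. (\<lambda>n. real (k n)) \<in> O(\<lambda>n. 1) \<and> has_width \<sigma> S T k)"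

definition sublinear_width ::
  "'r signature \<Rightarrow> ('r, 's) rel_structure \<Rightarrow> ('r, 't) rel_structure \<Rightarrow> bool" where
  "sublinear_width \<sigma> S T \<longleftrightarrow>
     (\<exists>k. (\<lambda>n. real (k n)) \<in> o(\<lambda>n. real n) \<and> has_width \<sigma> S T k)"

text \<open>Relations whose tuples are functions on an index set \<open>J\<close> of coordinates.\<close>

definition pr :: "'i \<Rightarrow> 'i \<Rightarrow> ('i \<Rightarrow> 'a) set \<Rightarrow> 'a rel" where
  "pr i j Q = {(a i, a j) | a. a \<in> Q}"

definition binary_projections :: "'i set \<Rightarrow> ('i \<Rightarrow> 'a) set \<Rightarrow> 'a rel set" where
  "binary_projections J Q = {pr i j Q | i j. i \<in> J \<and> j \<in> J \<and> i \<noteq> j}"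

text \<open>The coordinates of the product of all relations of a structure are the pairs \<open>(R, i)\<close> with
  \<open>i\<close> a coordinate of \<open>R\<close>. Using these instead of \<open>1, \<dots>, N\<close> (with \<open>N\<close> the sum of the arities)
  avoids fixing an order in which the tuples are concatenated; the set of binary projections
  does not depend on that order.\<close>

definition coords :: "'r signature \<Rightarrow> ('r \<times> nat) set" where
  "coords \<sigma> = (SIGMA R:syms \<sigma>. {..<arity \<sigma> R})"

definition product_relation ::
  "'r signature \<Rightarrow> ('r, 'a) rel_structure \<Rightarrow> ('r \<times> nat \<Rightarrow> 'a) set" where
  "product_relation \<sigma> A =
     (\<lambda>f. restrict (\<lambda>(R, i). f R ! i) (coords \<sigma>)) ` (\<Pi>\<^sub>E R\<in>syms \<sigma>. rel A R)"

definition structure_projections ::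
  "'r signature \<Rightarrow> ('r, 'a) rel_structure \<Rightarrow> 'a rel set" where
  "structure_projections \<sigma> A = binary_projections (coords \<sigma>) (product_relation \<sigma> A)"

definition reflexive :: "'r signature \<Rightarrow> ('r, 't) rel_structure \<Rightarrow> bool" where
  "reflexive \<sigma> T \<longleftrightarrow>
     (\<exists>a\<in>univ T. \<forall>R\<in>syms \<sigma>. replicate (arity \<sigma> R) a \<in> rel T R)"

text \<open>The theorem assumes that the relations of \<open>S\<close> are nonempty. If the sum of the arities is at
  least 2, this follows from the assumption on compositions. Otherwise there are no binary
  projections, that assumption is void, and the claim can fail: take a single unary symbol,
  interpreted by the empty relation in both \<open>S\<close> and \<open>T\<close>.\<close>

lemma relations_nonempty:
  assumes "univ S \<noteq> {}"
    and "\<forall>U\<in>structure_projections \<sigma> S. \<forall>V\<in>structure_projections \<sigma> S. U O V = univ S \<times> univ S"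
    and "c \<in> coords \<sigma>" "d \<in> coords \<sigma>" "c \<noteq> d" "R \<in> syms \<sigma>"
  shows "rel S R \<noteq> {}"
proof
  assume "rel S R = {}"
  then have "product_relation \<sigma> S = {}"
    using assms(6) by (auto simp: product_relation_def PiE_eq_empty_iff)
  moreover have "pr c d (product_relation \<sigma> S) \<in> structure_projections \<sigma> S"
    using assms(3-5) unfolding structure_projections_def binary_projections_def by blast
  ultimately have "{} \<in> structure_projections \<sigma> S" by (simp add: pr_def)
  then have "univ S \<times> univ S = {}" using assms(2) by fastforce
  then show False using assms(1) by auto
qed

end

theory Submission
  imports Defs
begin

text \<open>Replace the signature by one relation \<open>P\<close> of arity \<open>N\<close>, the product of all relations of
  \<open>S\<close>. For \<open>N \<ge> 2\<close> take a random \<open>N\<close>-uniform hypergraph on \<open>n\<close> vertices with \<open>C n\<close> edges, with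
  \<open>C\<close> a large constant, as an instance. Every set of \<open>n / |T|\<close> vertices contains an edge, so a
  homomorphism to \<open>T\<close> is constant on some edge, and \<open>T\<close> is reflexive. On the other hand,
  all sets of at most \<open>\<mu> n\<close> edges span almost as many vertices as a hypertree with the same
  number of edges. Such a set contains pendant edges or pairs of consecutive edges
  attached to the rest in at most two vertices; as \<open>U \<circ> V = S\<^sup>2\<close>, these impose no constraint on
  the rest, unless they contain pebbled vertices. Hence a minimal edge set to which a given
  partial assignment does not extend has size linear in the number of pebbles, and the partial
  assignments that extend to every set of \<open>m\<close> edges form a strategy for all \<open>k \<le> m / 14\<close>,
  where \<open>m\<close> is linear in \<open>n\<close>.\<close>

subsection \<open>Discharging in sparse hypergraphs\<close>

text \<open>Double counting: weight 1 gives the degree sum, the discharging weight gives the total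
  charge.\<close>

lemma sum_incidences:
  fixes f :: "'v \<Rightarrow> real"
  assumes "finite F" "\<And>e. e \<in> F \<Longrightarrow> finite (A e)"
  shows "(\<Sum>e\<in>F. \<Sum>v\<in>A e. f v) = (\<Sum>v\<in>(\<Union>e\<in>F. A e). real (card {e\<in>F. v \<in> A e}) * f v)"
proof -
  let ?V = "\<Union>e\<in>F. A e"
  have fin: "finite ?V" using assms by auto
  have "(\<Sum>v\<in>A e. f v) = (\<Sum>v\<in>?V. if v \<in> A e then f v else 0)" if "e \<in> F" for e
  proof -
    have "?V \<inter> {v. v \<in> A e} = A e" using that by auto
    then show ?thesis using fin by (simp add: sum.If_cases)
  qed
  then have "(\<Sum>e\<in>F. \<Sum>v\<in>A e. f v) = (\<Sum>v\<in>?V. \<Sum>e\<in>F. if v \<in> A e then f v else 0)"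
    by (simp add: sum.swap[of _ F])
  also have "\<dots> = (\<Sum>v\<in>?V. real (card {e\<in>F. v \<in> A e}) * f v)"
  proof (rule sum.cong[OF refl])
    fix v
    have "F \<inter> {e. v \<in> A e} = {e\<in>F. v \<in> A e}" by auto
    then show "(\<Sum>e\<in>F. if v \<in> A e then f v else 0) = real (card {e\<in>F. v \<in> A e}) * f v"
      using assms(1) by (simp add: sum.If_cases)
  qed
  finally show ?thesis .
qed

text \<open>The pebbled vertices \<open>D\<close> are counted as one further edge. An edge with at most one junction
  can be deleted from a minimal unsatisfiable set, and so can two link edges that meet outside
  \<open>D\<close>.\<close>

definition load :: "('e \<Rightarrow> 'v set) \<Rightarrow> 'e set \<Rightarrow> 'v set \<Rightarrow> 'v \<Rightarrow> nat" where
  "load A F D v = card {e\<in>F. v \<in> A e} + (if v \<in> D then 1 else 0)"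

definition junctions :: "('e \<Rightarrow> 'v set) \<Rightarrow> 'e set \<Rightarrow> 'v set \<Rightarrow> 'e \<Rightarrow> 'v set" where
  "junctions A F D e = {v \<in> A e. load A F D v \<ge> 2}"

text \<open>For \<open>e\<close> in \<open>F\<close>, each of the two junctions carries exactly one
  further edge, with \<open>D\<close> counted as an edge. Links are thus the inner edges of
  paths.\<close>

definition link :: "('e \<Rightarrow> 'v set) \<Rightarrow> 'e set \<Rightarrow> 'v set \<Rightarrow> 'e \<Rightarrow> bool" where
  "link A F D e \<longleftrightarrow> card (junctions A F D e) = 2 \<and> (\<forall>v\<in>junctions A F D e. load A F D v = 2)"

lemma load_pos:
  assumes "finite F" "e \<in> F" "v \<in> A e"
  shows "load A F D v \<ge> 1"
proof -
  have "card {e\<in>F. v \<in> A e} \<noteq> 0" using assms by auto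
  then show ?thesis by (simp add: load_def)
qed

lemma load_one:
  assumes "finite F" "e \<in> F" "v \<in> A e" "load A F D v < 2"
  shows "v \<notin> D \<and> (\<forall>e'\<in>F. v \<in> A e' \<longrightarrow> e' = e)"
proof -
  have "card {e\<in>F. v \<in> A e} \<noteq> 0" using assms by auto
  then have *: "card {e\<in>F. v \<in> A e} = 1" "v \<notin> D"
    using assms(4) by (auto simp: load_def split: if_splits)
  then obtain x where "{e\<in>F. v \<in> A e} = {x}" by (auto simp: card_1_singleton_iff)
  then have "y = x" if "y \<in> F" "v \<in> A y" for y using that by auto
  then show ?thesis using assms(2,3) *(2) by blast
qed

lemma load_two:
  assumes "finite F" "load A F D v = 2" "v \<notin> D" "e \<in> F" "e' \<in> F" "e \<noteq> e'" "v \<in> A e" "v \<in> A e'"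
  shows "\<forall>x\<in>F. v \<in> A x \<longrightarrow> x = e \<or> x = e'"
proof -
  have "card {e\<in>F. v \<in> A e} = 2" using assms by (simp add: load_def)
  moreover have "{e, e'} \<subseteq> {e\<in>F. v \<in> A e}" "card {e, e'} = 2" using assms by auto
  ultimately have "{e, e'} = {e\<in>F. v \<in> A e}" using assms(1) by (intro card_subset_eq) auto
  then show ?thesis by auto
qed

text \<open>Send each pair of a link and one of its junctions to the junction. This is injective:
  links share no junction outside \<open>D\<close> by \<open>sep\<close>, and a vertex of load 2 in
  \<open>D\<close> lies on one edge only. A junction outside \<open>D\<close> has a second edge,
  which by \<open>sep\<close> is not a link, so all images lie in \<open>D\<close> or among the
  junctions of non-links.\<close>

lemma card_links:
  assumes fin: "finite F" "\<And>e. e \<in> F \<Longrightarrow> finite (A e)" "finite D"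
    and sep: "\<And>e e' v. e \<in> F \<Longrightarrow> e' \<in> F \<Longrightarrow> e \<noteq> e' \<Longrightarrow> v \<in> A e \<Longrightarrow> v \<in> A e' \<Longrightarrow>
       v \<notin> D \<Longrightarrow> link A F D e \<Longrightarrow> link A F D e' \<Longrightarrow> False"
  shows "2 * card {e\<in>F. link A F D e} \<le>
     card D + (\<Sum>e\<in>{e\<in>F. \<not> link A F D e}. card (junctions A F D e))"
proof -
  define G where "G = {e\<in>F. link A F D e}"
  define B where "B = {e\<in>F. \<not> link A F D e}"
  let ?Q = "junctions A F D"
  have finQ: "finite (?Q e)" if "e \<in> F" for e using fin(2)[OF that] by (simp add: junctions_def)
  have inj: "inj_on snd (Sigma G ?Q)"
  proof (rule inj_onI, clarsimp)
    fix e e' v assume *: "e \<in> G" "v \<in> ?Q e" "e' \<in> G" "v \<in> ?Q e'"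
    then have **: "e \<in> F" "e' \<in> F" "v \<in> A e" "v \<in> A e'" "load A F D v = 2"
      by (auto simp: G_def junctions_def link_def)
    show "e = e'"
    proof (cases "v \<in> D")
      case True
      then have "card {e\<in>F. v \<in> A e} = 1" using **(5) by (simp add: load_def)
      then obtain x where "{e\<in>F. v \<in> A e} = {x}" by (auto simp: card_1_singleton_iff)
      then have "y = x" if "y \<in> F" "v \<in> A y" for y using that by auto
      then show ?thesis using **(1-4) by blast
    next
      case False
      then show ?thesis using sep[of e e' v] * ** by (auto simp: G_def)
    qed
  qed
  have "snd ` Sigma G ?Q \<subseteq> D \<union> (\<Union>e\<in>B. ?Q e)"
  proof clarsimp
    fix e v assume *: "e \<in> G" "v \<in> ?Q e" "\<forall>e\<in>B. v \<notin> ?Q e"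
    show "v \<in> D"
    proof (rule ccontr)
      assume D: "v \<notin> D"
      have e: "e \<in> F" "v \<in> A e" "load A F D v = 2" using * by (auto simp: G_def junctions_def link_def)
      then have c2: "card {e\<in>F. v \<in> A e} = 2" using D by (simp add: load_def)
      have "\<exists>e'\<in>F. v \<in> A e' \<and> e' \<noteq> e"
      proof (rule ccontr)
        assume "\<not> ?thesis"
        then have "{e\<in>F. v \<in> A e} \<subseteq> {e}" by auto
        then have "card {e\<in>F. v \<in> A e} \<le> card {e}" by (intro card_mono) auto
        then show False using c2 by simp
      qed
      then obtain e' where e': "e' \<in> F" "v \<in> A e'" "e' \<noteq> e" by auto
      have "v \<in> ?Q e'" using e e' by (simp add: junctions_def)
      then have "e' \<in> G" using *(3) e' by (auto simp: B_def G_def)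
      then show False using sep[of e e' v] e e' D * by (auto simp: G_def)
    qed
  qed
  then have "card (snd ` Sigma G ?Q) \<le> card (D \<union> (\<Union>e\<in>B. ?Q e))"
    using fin finQ by (intro card_mono) (auto simp: B_def)
  also have "\<dots> \<le> card D + card (\<Union>e\<in>B. ?Q e)" by (rule card_Un_le)
  also have "\<dots> \<le> card D + (\<Sum>e\<in>B. card (?Q e))"
    using card_UN_le[of B ?Q] fin by (simp add: B_def)
  finally have "card (Sigma G ?Q) \<le> card D + (\<Sum>e\<in>B. card (?Q e))"
    by (simp add: card_image[OF inj])
  moreover have "card (Sigma G ?Q) = (\<Sum>e\<in>G. card (?Q e))"
    using fin finQ by (intro card_SigmaI) (auto simp: G_def)
  moreover have "(\<Sum>e\<in>G. card (?Q e)) = (\<Sum>e\<in>G. 2)"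
    by (rule sum.cong) (auto simp: G_def link_def)
  ultimately show ?thesis by (simp add: G_def B_def)
qed

text \<open>Each vertex \<open>v\<close> gives \<open>1 - 1 / load v\<close> to each of its edges. By sparsity the edges receive at
  most \<open>27/26\<close> on average, up to a term from \<open>D\<close>. Every edge receives at least \<open>1\<close>, and
  at least \<open>7/6\<close> if it is not a link, so few edges are not links; but the junctions of the
  links are absorbed by \<open>D\<close> and by the edges that are not links.\<close>

lemma card_le_of_sparse:
  assumes fin: "finite F" "\<And>e. e \<in> F \<Longrightarrow> finite (A e)" "finite D"
    and unif: "\<And>e. e \<in> F \<Longrightarrow> card (A e) = N"
    and two: "\<And>e. e \<in> F \<Longrightarrow> card (junctions A F D e) \<ge> 2"
    and sep: "\<And>e e' v. e \<in> F \<Longrightarrow> e' \<in> F \<Longrightarrow> e \<noteq> e' \<Longrightarrow> v \<in> A e \<Longrightarrow> v \<in> A e' \<Longrightarrow>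
       v \<notin> D \<Longrightarrow> link A F D e \<Longrightarrow> link A F D e' \<Longrightarrow> False"
    and sparse: "26 * N * card F \<le> 26 * card (\<Union>e\<in>F. A e) + 27 * card F"
  shows "card F \<le> 14 * card D"
proof -
  define V where "V = (\<Union>e\<in>F. A e)"
  define G where "G = {e\<in>F. link A F D e}"
  define B where "B = {e\<in>F. \<not> link A F D e}"
  define d where "d = load A F D"
  define deg where "deg = (\<lambda>v. card {e\<in>F. v \<in> A e})"
  let ?Q = "junctions A F D"
  define g where "g = (\<lambda>v. 1 - 1 / real (d v))"
  define \<phi> where "\<phi> = (\<lambda>e. \<Sum>v\<in>A e. g v)"
  have finV: "finite V" using fin by (auto simp: V_def)
  have finQ: "finite (?Q e)" if "e \<in> F" for e using fin(2)[OF that] by (simp add: junctions_def)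
  have "(\<Sum>e\<in>F. \<Sum>v\<in>A e. 1) = (\<Sum>v\<in>V. real (deg v) * 1)"
    using sum_incidences[OF fin(1,2), where f = "\<lambda>_. 1"] unfolding V_def deg_def by simp
  then have degs: "(\<Sum>v\<in>V. real (deg v)) = real N * card F" using unif by (simp add: mult.commute)
  have "(\<Sum>e\<in>F. \<phi> e) = (\<Sum>v\<in>V. deg v * g v)"
    using sum_incidences[OF fin(1,2), where f = g] unfolding V_def deg_def \<phi>_def by simp
  \<comment> \<open>Outside \<open>D\<close> the load is the degree and the term is
    \<open>deg v - 1\<close>; in \<open>D\<close> the load is \<open>deg v + 1\<close> and the term
    is \<open>deg v - 1 + 1 / (deg v + 1)\<close>.\<close>
  also have "\<dots> \<le> (\<Sum>v\<in>V. real (deg v) - 1 + (if v \<in> D then 1/2 else 0))"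
  proof (rule sum_mono)
    fix v assume "v \<in> V"
    then have "deg v \<noteq> 0" using fin by (auto simp: V_def deg_def)
    then have "real (deg v) \<ge> 1" by simp
    moreover have "real (d v) = deg v + (if v \<in> D then 1 else 0)"
      by (simp add: d_def load_def deg_def)
    ultimately show "deg v * g v \<le> real (deg v) - 1 + (if v \<in> D then 1/2 else 0)"
      by (auto simp: g_def field_simps)
  qed
  also have "\<dots> = real N * card F - card V + card (V \<inter> D) / 2"
    using degs finV by (simp add: sum.distrib sum_subtractf sum.If_cases)
  also have "\<dots> \<le> real N * card F - card V + card D / 2"
    using card_mono[of D "V \<inter> D"] fin by simp
  also have "\<dots> \<le> 27/26 * card F + card D / 2"
  proof -
    have "real (26 * N * card F) \<le> real (26 * card V + 27 * card F)"
      using sparse unfolding V_def by (rule of_nat_mono)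
    then show ?thesis by simp
  qed
  finally have total: "(\<Sum>e\<in>F. \<phi> e - 1) \<le> 1/26 * card F + card D / 2"
    by (simp add: sum_subtractf)
  have g0: "g v \<ge> 0" if "e \<in> F" "v \<in> A e" for e v
  proof -
    have "real (d v) \<ge> 1" using load_pos[OF fin(1) that(1), of v A D] that by (simp add: d_def)
    then show ?thesis by (simp add: g_def)
  qed
  have \<phi>Q: "\<phi> e \<ge> (\<Sum>v\<in>?Q e. g v)" if "e \<in> F" for e
    unfolding \<phi>_def using fin(2)[OF that] g0[OF that]
    by (intro sum_mono2) (auto simp: junctions_def)
  have g2: "g v \<ge> 1/2" if "v \<in> ?Q e" for e v
    using that by (auto simp: junctions_def g_def d_def field_simps)
  have \<phi>2: "\<phi> e \<ge> card (?Q e) / 2" if "e \<in> F" for e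
  proof -
    have "card (?Q e) / 2 = (\<Sum>v\<in>?Q e. 1/2)" by simp
    also have "\<dots> \<le> (\<Sum>v\<in>?Q e. g v)" by (intro sum_mono g2)
    finally show ?thesis using \<phi>Q[OF that] by simp
  qed
  \<comment> \<open>Three junctions give at least 3/2. If there are only two, one has load at least
    3, which gives 2/3 + 1/2.\<close>
  have \<phi>B: "\<phi> e \<ge> 7/6" if "e \<in> B" for e
  proof -
    have e: "e \<in> F" "\<not> link A F D e" using that by (auto simp: B_def)
    show ?thesis
    proof (cases "card (?Q e) = 2")
      case False
      then have "card (?Q e) \<ge> 3" using two[OF e(1)] by simp
      then show ?thesis using \<phi>2[OF e(1)] by simp
    next
      case True
      then obtain v where v: "v \<in> ?Q e" "load A F D v \<noteq> 2" using e by (auto simp: link_def)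
      then have "d v \<ge> 3" by (auto simp: junctions_def d_def)
      then have "g v \<ge> 2/3" by (simp add: g_def field_simps)
      moreover have "(\<Sum>x\<in>?Q e. g x) = g v + (\<Sum>x\<in>?Q e - {v}. g x)"
        using finQ[OF e(1)] v by (simp add: sum.remove)
      moreover have "(\<Sum>x\<in>?Q e - {v}. 1/2) \<le> (\<Sum>x\<in>?Q e - {v}. g x)"
        by (intro sum_mono) (use g2 in blast)
      moreover have "card (?Q e - {v}) = 1" using True v finQ[OF e(1)] by simp
      ultimately show ?thesis using \<phi>Q[OF e(1)] by simp
    qed
  qed
  have split: "F = G \<union> B" "G \<inter> B = {}" "finite G" "finite B"
    using fin by (auto simp: G_def B_def)
  have "(\<Sum>e\<in>B. \<phi> e - 1) \<le> (\<Sum>e\<in>F. \<phi> e - 1)"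
  proof (rule sum_mono2)
    fix e assume "e \<in> F - B"
    then show "0 \<le> \<phi> e - 1" using \<phi>2[of e] two[of e] by auto
  qed (use split in auto)
  then have tB: "(\<Sum>e\<in>B. \<phi> e - 1) \<le> 1/26 * card F + card D / 2" using total by simp
  have "card B / 6 = (\<Sum>e\<in>B. 1/6)" by simp
  also have "\<dots> \<le> (\<Sum>e\<in>B. \<phi> e - 1)" by (intro sum_mono) (use \<phi>B in force)
  finally have cB: "card B / 6 \<le> 1/26 * card F + card D / 2" using tB by simp
  \<comment> \<open>\<open>card (?Q e)\<close> is at most \<open>2 * \<phi> e\<close>, and this is
    at most \<open>14 * (\<phi> e - 1)\<close> exactly when
    \<open>\<phi> e \<ge> 7/6\<close>.\<close>
  have "(\<Sum>e\<in>B. real (card (?Q e))) \<le> (\<Sum>e\<in>B. 14 * (\<phi> e - 1))"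
  proof (rule sum_mono)
    fix e assume "e \<in> B"
    then show "real (card (?Q e)) \<le> 14 * (\<phi> e - 1)" using \<phi>B[of e] \<phi>2[of e] by (auto simp: B_def)
  qed
  also have "\<dots> = 14 * (\<Sum>e\<in>B. \<phi> e - 1)" by (simp add: sum_distrib_left)
  finally have sB: "(\<Sum>e\<in>B. real (card (?Q e))) \<le> 14 * (1/26 * card F + card D / 2)" using tB by simp
  have "2 * card G \<le> card D + (\<Sum>e\<in>B. card (?Q e))"
    unfolding G_def B_def by (rule card_links) (use fin sep in metis)+
  then have "real (2 * card G) \<le> real (card D + (\<Sum>e\<in>B. card (?Q e)))" by (rule of_nat_mono)
  then have cG: "2 * real (card G) \<le> card D + 14 * (1/26 * card F + card D / 2)" using sB by simp
  \<comment> \<open>There are at most \<open>6/26 * card F + 3 * card D\<close> non-links and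
    \<open>7/26 * card F + 4 * card D\<close> links. Together this is half of \<open>card F\<close>
    plus \<open>7 * card D\<close>, hence the factor 14.\<close>
  have "card F = card G + card B" using split card_Un_disjoint[of G B] by simp
  then have "real (card F) = real (card G) + real (card B)" by simp
  then have "real (card F) \<le> 14 * real (card D)" using cB cG by argo
  then show ?thesis by linarith
qed

subsection \<open>Minimal unsatisfiable edge sets\<close>

text \<open>An edge is a map from coordinates to vertices, which records the position of each vertex
  in the constraint. \<open>restrict\<close> gives \<open>g \<circ> e\<close> the extensional form
  of the tuples of \<open>P\<close>.\<close>

definition satisfiable_from ::
  "'s set \<Rightarrow> 'i set \<Rightarrow> ('i \<Rightarrow> 's) set \<Rightarrow> ('v \<rightharpoonup> 's) \<Rightarrow> ('i \<Rightarrow> 'v) set \<Rightarrow> bool" where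
  "satisfiable_from S J P h F \<longleftrightarrow>
     (\<exists>g. range g \<subseteq> S \<and> (\<forall>x\<in>dom h. h x = Some (g x)) \<and> (\<forall>e\<in>F. restrict (g \<circ> e) J \<in> P))"

lemma satisfiable_from_restrict:
  "satisfiable_from S J P h F \<Longrightarrow> satisfiable_from S J P (h |` X) F"
  unfolding satisfiable_from_def by (auto simp: restrict_map_def dom_def)

text \<open>\<open>P\<close> abstracts the product of all relations and \<open>J\<close> its
  coordinates, so that the satisfiability arguments need no signature.\<close>

locale composable =
  fixes J :: "'i set" and S :: "'s set" and P :: "('i \<Rightarrow> 's) set"
  assumes P_sub: "P \<subseteq> J \<rightarrow>\<^sub>E S"
    and comp: "\<And>U V. U \<in> binary_projections J P \<Longrightarrow> V \<in> binary_projections J P \<Longrightarrow> U O V = S \<times> S"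
    and S_ne: "S \<noteq> {}" and finS: "finite S"
    and finJ: "finite J" and J2: "card J \<ge> 2"
begin

lemma P_value: "p \<in> P \<Longrightarrow> i \<in> J \<Longrightarrow> p i \<in> S"
  using P_sub by auto

text \<open>The composition hypothesis as used below: two consecutive edges impose nothing on the
  values at their outer ends.\<close>

lemma link_two:
  assumes "i \<in> J" "j \<in> J" "i \<noteq> j" "i' \<in> J" "j' \<in> J" "i' \<noteq> j'" "a \<in> S" "b \<in> S"
  obtains p p' where "p \<in> P" "p' \<in> P" "p i = a" "p j = p' i'" "p' j' = b"
proof -
  have "pr i j P O pr i' j' P = S \<times> S"
    using assms by (intro comp) (auto simp: binary_projections_def)
  then have "(a, b) \<in> pr i j P O pr i' j' P" using assms by auto
  then show ?thesis using that by (auto simp: pr_def)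
qed

lemma tuple_with_value:
  assumes "i \<in> J" "a \<in> S"
  obtains p where "p \<in> P" "p i = a"
proof -
  have "\<not> J \<subseteq> {i}" using J2 finJ card_mono[of "{i}" J] by auto
  then obtain j where "j \<in> J" "i \<noteq> j" by auto
  then show ?thesis using link_two[of i j i j a a] assms that by metis
qed

lemma restrict_comp_inv_into:
  assumes "inj_on e J" "p \<in> P" "\<And>j. j \<in> J \<Longrightarrow> g (e j) = p (inv_into J e (e j))"
  shows "restrict (g \<circ> e) J \<in> P"
proof -
  have "restrict (g \<circ> e) J = p"
    using assms subsetD[OF P_sub assms(2)] by (auto simp: fun_eq_iff restrict_def)
  then show ?thesis using assms by simp
qed

text \<open>Keep the value at the attaching vertex \<open>u\<close>, choose a tuple of
  \<open>P\<close> with this value there, and overwrite the other vertices of \<open>e\<close>,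
  which are private and carry no pebble.\<close>

lemma satisfiable_from_leaf:
  assumes inj: "inj_on e J"
    and sat: "satisfiable_from S J P h (F - {e})"
    and u: "u \<in> e ` J"
    and priv: "\<And>x e'. x \<in> e ` J \<Longrightarrow> x \<noteq> u \<Longrightarrow> x \<notin> dom h \<and> (e' \<in> F \<longrightarrow> x \<in> e' ` J \<longrightarrow> e' = e)"
  shows "satisfiable_from S J P h F"
proof -
  obtain g where g: "range g \<subseteq> S" "\<And>x. x \<in> dom h \<Longrightarrow> h x = Some (g x)"
    "\<And>e'. e' \<in> F - {e} \<Longrightarrow> restrict (g \<circ> e') J \<in> P"
    using sat unfolding satisfiable_from_def by auto
  obtain i where i: "i \<in> J" "u = e i" using u by auto
  have "g u \<in> S" using g by auto
  then obtain p where p: "p \<in> P" "p i = g u" using tuple_with_value i by metis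
  define g' where "g' = (\<lambda>x. if x \<in> e ` J then p (inv_into J e x) else g x)"
  have g'u: "g' u = g u" using u i inj p by (simp add: g'_def)
  have "range g' \<subseteq> S"
    using g(1) P_value[OF p(1)] inj by (auto simp: g'_def)
  moreover have "h x = Some (g' x)" if "x \<in> dom h" for x
    using g(2)[OF that] priv[of x] that g'u by (cases "x = u") (auto simp: g'_def)
  moreover have "restrict (g' \<circ> e') J \<in> P" if e': "e' \<in> F" for e'
  proof (cases "e' = e")
    case True
    show ?thesis unfolding True
      by (rule restrict_comp_inv_into[OF inj p(1)]) (simp add: g'_def)
  next
    case False
    have "g' (e' j) = g (e' j)" if "j \<in> J" for j
      using priv[of "e' j" e'] that e' False g'u by (cases "e' j = u") (auto simp: g'_def)
    then have "restrict (g' \<circ> e') J = restrict (g \<circ> e') J" by auto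
    then show ?thesis using g(3) e' False by simp
  qed
  ultimately show ?thesis unfolding satisfiable_from_def by blast
qed

text \<open>Keep the values at \<open>u\<close> and \<open>w\<close>; \<open>link_two\<close>
  supplies tuples for \<open>e\<close> and \<open>e'\<close> that agree at \<open>v\<close>. The
  overwritten vertices lie on no other edge and carry no pebble.\<close>

lemma satisfiable_from_path:
  assumes inj: "inj_on e J" "inj_on e' J"
    and ne: "e \<noteq> e'" "e \<in> F" "e' \<in> F"
    and sat: "satisfiable_from S J P h (F - {e, e'})"
    and uv: "u \<in> e ` J" "v \<in> e ` J" "u \<noteq> v" and vw: "v \<in> e' ` J" "w \<in> e' ` J" "w \<noteq> v"
    and priv: "\<And>x y. x \<in> e ` J \<Longrightarrow> x \<noteq> u \<Longrightarrow> x \<noteq> v \<Longrightarrow> x \<notin> dom h \<and> (y \<in> F \<longrightarrow> x \<in> y ` J \<longrightarrow> y = e)"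
    and priv': "\<And>x y. x \<in> e' ` J \<Longrightarrow> x \<noteq> v \<Longrightarrow> x \<noteq> w \<Longrightarrow> x \<notin> dom h \<and> (y \<in> F \<longrightarrow> x \<in> y ` J \<longrightarrow> y = e')"
    and v: "v \<notin> dom h" "\<And>y. y \<in> F \<Longrightarrow> v \<in> y ` J \<Longrightarrow> y = e \<or> y = e'"
  shows "satisfiable_from S J P h F"
proof -
  obtain g where g: "range g \<subseteq> S" "\<And>x. x \<in> dom h \<Longrightarrow> h x = Some (g x)"
    "\<And>y. y \<in> F - {e, e'} \<Longrightarrow> restrict (g \<circ> y) J \<in> P"
    using sat unfolding satisfiable_from_def by auto
  obtain i j i' j' where ij: "i \<in> J" "u = e i" "j \<in> J" "v = e j" "i' \<in> J" "v = e' i'" "j' \<in> J" "w = e' j'"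
    using uv vw by blast
  have ne': "i \<noteq> j" "i' \<noteq> j'" using ij uv vw by auto
  have "g u \<in> S" "g w \<in> S" using g by auto
  then obtain p p' where p: "p \<in> P" "p' \<in> P" "p i = g u" "p j = p' i'" "p' j' = g w"
    using link_two[OF ij(1,3) ne'(1) ij(5,7) ne'(2)] by metis
  define g' where "g' = (\<lambda>x. if x \<in> e ` J then p (inv_into J e x)
                            else if x \<in> e' ` J then p' (inv_into J e' x) else g x)"
  have inv: "inv_into J e u = i" "inv_into J e v = j" "inv_into J e' v = i'" "inv_into J e' w = j'"
    using ij inj by (metis inv_into_f_f)+
  have g'u: "g' u = g u" using uv inv p by (simp add: g'_def)
  have g'v: "g' v = p' i'" using uv inv p by (simp add: g'_def)
  \<comment> \<open>The outer ends may coincide; then both tuples take the value \<open>g u\<close>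
    there.\<close>
  have g'w: "g' w = g w"
  proof (cases "w \<in> e ` J")
    case True
    then have "w = u" using priv[of w e'] vw ne by auto
    then show ?thesis using g'u by simp
  next
    case False
    then show ?thesis using vw inv p by (simp add: g'_def)
  qed
  have "range g' \<subseteq> S"
    using g(1) P_value[OF p(1)] P_value[OF p(2)] inj by (auto simp: g'_def)
  moreover have "h x = Some (g' x)" if "x \<in> dom h" for x
  proof (cases "x = u \<or> x = w")
    case True
    then show ?thesis using g(2)[OF that] g'u g'w by auto
  next
    case False
    then have "x \<notin> e ` J" "x \<notin> e' ` J" using priv[of x] priv'[of x] v that by auto
    then show ?thesis using g(2)[OF that] by (simp add: g'_def)
  qed
  moreover have "restrict (g' \<circ> y) J \<in> P" if y: "y \<in> F" for y
  proof -
    consider "y = e" | "y = e'" | "y \<noteq> e" "y \<noteq> e'" by blast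
    then show ?thesis
    proof cases
      case 1
      show ?thesis unfolding 1
        by (rule restrict_comp_inv_into[OF inj(1) p(1)]) (simp add: g'_def)
    next
      case 2
      have "g' x = p' (inv_into J e' x)" if x: "x \<in> e' ` J" for x
      proof (cases "x \<in> e ` J")
        case True
        then have "x = v \<or> x = w" using priv'[of x e] x ne by auto
        then show ?thesis using g'v g'w inv p by auto
      qed (use x in \<open>simp add: g'_def\<close>)
      then show ?thesis unfolding 2
        by (intro restrict_comp_inv_into[OF inj(2) p(2)]) simp
    next
      case 3
      have "g' (y k) = g (y k)" if "k \<in> J" for k
      proof (cases "y k = u \<or> y k = w")
        case True
        then show ?thesis using g'u g'w by auto
      next
        case False
        have "y k \<noteq> v" using v(2)[OF y] 3 that by auto
        then have "y k \<notin> e ` J" "y k \<notin> e' ` J"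
          using priv[of "y k" y] priv'[of "y k" y] False 3 y that by auto
        then show ?thesis by (simp add: g'_def)
      qed
      then have "restrict (g' \<circ> y) J = restrict (g \<circ> y) J" by auto
      then show ?thesis using g(3) y 3 by simp
    qed
  qed
  ultimately show ?thesis unfolding satisfiable_from_def by blast
qed

text \<open>An edge with at most one junction would contradict minimality by
  \<open>satisfiable_from_leaf\<close>, and two links meeting outside the pebbles by
  \<open>satisfiable_from_path\<close>. So the discharging bound applies with
  \<open>D = dom h\<close>.\<close>

lemma card_minimal_unsatisfiable:
  fixes F :: "('i \<Rightarrow> 'v) set" and h :: "'v \<rightharpoonup> 's"
  assumes fin: "finite F" "finite (dom h)" and inj: "\<And>e. e \<in> F \<Longrightarrow> inj_on e J"
    and unsat: "\<not> satisfiable_from S J P h F"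
    and minimal: "\<And>F'. F' \<subset> F \<Longrightarrow> satisfiable_from S J P h F'"
    and sparse: "26 * card J * card F \<le> 26 * card (\<Union>e\<in>F. e ` J) + 27 * card F"
  shows "card F \<le> 14 * card (dom h)"
proof (rule card_le_of_sparse[where A = "\<lambda>e. e ` J" and N = "card J"])
  let ?A = "\<lambda>e::'i \<Rightarrow> 'v. e ` J"
  let ?Q = "junctions ?A F (dom h)"
  have finQ: "finite (?Q e)" for e using finJ by (simp add: junctions_def)
  have one: "x \<notin> dom h \<and> (y \<in> F \<longrightarrow> x \<in> y ` J \<longrightarrow> y = e)" if "e \<in> F" "x \<in> e ` J" "x \<notin> ?Q e" for e x y
  proof -
    have "load ?A F (dom h) x < 2" using that by (simp add: junctions_def)
    then show ?thesis using load_one[where A = ?A, OF fin(1) that(1,2)] by blast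
  qed
  show "card (?Q e) \<ge> 2" if e: "e \<in> F" for e
  proof (rule ccontr)
    assume "\<not> ?thesis"
    then have c1: "card (?Q e) \<le> 1" by simp
    have J_ne: "J \<noteq> {}" using J2 by auto
    \<comment> \<open>Without any junction, every vertex of \<open>e\<close> can serve as
      \<open>u\<close>.\<close>
    have "\<exists>u\<in>e ` J. ?Q e \<subseteq> {u}"
    proof (cases "?Q e = {}")
      case False
      then obtain u where u: "u \<in> ?Q e" by auto
      then have "?Q e \<subseteq> {u}" using c1 finQ card_le_Suc0_iff_eq[of "?Q e"] by auto
      moreover have "u \<in> e ` J" using u by (simp add: junctions_def)
      ultimately show ?thesis by blast
    qed (use J_ne in auto)
    then obtain u where u: "u \<in> e ` J" "?Q e \<subseteq> {u}" by auto
    have "satisfiable_from S J P h F"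
      using u one[OF e] e
      by (intro satisfiable_from_leaf[OF inj[OF e] minimal u(1)]) blast+
    then show False using unsat by simp
  qed
  show False
    if e: "e \<in> F" "e' \<in> F" "e \<noteq> e'" "v \<in> e ` J" "v \<in> e' ` J" "v \<notin> dom h"
      "link ?A F (dom h) e" "link ?A F (dom h) e'" for e e' v
  proof -
    have "card {y\<in>F. v \<in> y ` J} \<ge> card {e, e'}" using e fin by (intro card_mono) auto
    then have "load ?A F (dom h) v \<ge> 2" using e(3) by (simp add: load_def)
    then have vQ: "v \<in> ?Q e" "v \<in> ?Q e'" using e by (auto simp: junctions_def)
    have c: "card (?Q e) = 2" "card (?Q e') = 2" "load ?A F (dom h) v = 2"
      using e vQ by (auto simp: link_def)
    have "\<exists>u. ?Q e = {u, v} \<and> u \<noteq> v" "\<exists>w. ?Q e' = {v, w} \<and> w \<noteq> v"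
      using c(1,2) vQ by (auto simp: card_2_iff)
    then obtain u w where uw: "?Q e = {u, v}" "u \<noteq> v" "?Q e' = {v, w}" "w \<noteq> v" by auto
    have "satisfiable_from S J P h F"
    proof (rule satisfiable_from_path[of e e' F h u v w])
      show "u \<in> e ` J" "w \<in> e' ` J" using uw by (auto simp: junctions_def)
      show "satisfiable_from S J P h (F - {e, e'})" using e by (intro minimal) auto
      show "y = e \<or> y = e'" if "y \<in> F" "v \<in> y ` J" for y
        using load_two[where A = ?A, OF fin(1) c(3) e(6,1,2,3,4,5)] that by auto
    qed (use uw one[OF e(1)] one[OF e(2)] e inj in auto)
    then show False using unsat by simp
  qed
qed (use assms finJ card_image in auto)

end

subsection \<open>The strategy\<close>

context composable
begin

text \<open>Induction on subsets: if all proper subsets are satisfiable, an unsatisfiable set would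
  be minimal, hence of size at most \<open>14 * card (dom h)\<close>, which \<open>small\<close>
  excludes.\<close>

lemma satisfiable_from_sparse:
  fixes F :: "('i \<Rightarrow> 'v) set" and h :: "'v \<rightharpoonup> 's"
  assumes fin: "finite F" "finite (dom h)" and inj: "\<And>e. e \<in> F \<Longrightarrow> inj_on e J"
    and sparse: "\<And>F'. F' \<subseteq> F \<Longrightarrow> 26 * card J * card F' \<le> 26 * card (\<Union>e\<in>F'. e ` J) + 27 * card F'"
    and small: "\<And>F'. F' \<subseteq> F \<Longrightarrow> card F' \<le> 14 * card (dom h) \<Longrightarrow> satisfiable_from S J P h F'"
  shows "satisfiable_from S J P h F"
proof -
  have "satisfiable_from S J P h F'" if "F' \<subseteq> F" for F'
    using finite_subset[OF that fin(1)] that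
  proof (induction F' rule: finite_psubset_induct)
    case (psubset F')
    show ?case
    proof (rule ccontr)
      assume unsat: "\<not> ?thesis"
      have "satisfiable_from S J P h F''" if "F'' \<subset> F'" for F'' using psubset that by blast
      then have "card F' \<le> 14 * card (dom h)"
        using psubset inj fin unsat sparse
        by (intro card_minimal_unsatisfiable) auto
      then show False using small psubset.prems unsat by blast
    qed
  qed
  then show ?thesis by blast
qed

lemma satisfiable_from_empty: "satisfiable_from S J P Map.empty {}"
proof -
  obtain s where "s \<in> S" using S_ne by auto
  then show ?thesis unfolding satisfiable_from_def by (intro exI[of _ "\<lambda>_. s"]) auto
qed

text \<open>This family will be the strategy. Consistency is tested on up to \<open>m\<close> edges
  anywhere, not only on those inside \<open>dom h\<close>; this is what makes extension
  possible.\<close>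

definition locally_satisfiable :: "'v set \<Rightarrow> nat \<Rightarrow> ('i \<Rightarrow> 'v) set \<Rightarrow> ('v \<rightharpoonup> 's) set" where
  "locally_satisfiable X m E =
     {h. dom h \<subseteq> X \<and> (\<forall>F\<subseteq>E. card F \<le> m \<longrightarrow> satisfiable_from S J P h F)}"

text \<open>Without pebbles the bound \<open>14 * card (dom h)\<close> is 0, so only the empty edge
  set needs a direct check.\<close>

lemma empty_locally_satisfiable:
  fixes E :: "('i \<Rightarrow> 'v) set"
  assumes "finite E" "\<And>e. e \<in> E \<Longrightarrow> inj_on e J"
    and "\<And>F. F \<subseteq> E \<Longrightarrow> card F \<le> m \<Longrightarrow> 26 * card J * card F \<le> 26 * card (\<Union>e\<in>F. e ` J) + 27 * card F"
  shows "Map.empty \<in> locally_satisfiable X m E"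
proof -
  have "satisfiable_from S J P Map.empty F" if F: "F \<subseteq> E" "card F \<le> m" for F
  proof (rule satisfiable_from_sparse)
    show fin: "finite F" using F assms finite_subset by blast
    fix F' assume F': "F' \<subseteq> F"
    then show "26 * card J * card F' \<le> 26 * card (\<Union>e\<in>F'. e ` J) + 27 * card F'"
      using F card_mono[OF fin F'] by (intro assms) auto
    assume "card F' \<le> 14 * card (dom (Map.empty :: 'v \<rightharpoonup> 's))"
    then have "F' = {}" using finite_subset[OF F' fin] by simp
    then show "satisfiable_from S J P Map.empty F'" using satisfiable_from_empty by simp
  qed (use F assms in auto)
  then show ?thesis by (simp add: locally_satisfiable_def)
qed

text \<open>If no value for a new vertex \<open>x\<close> is admissible, then each value \<open>s\<close> has a small witness of
  unsatisfiability, and \<open>h\<close> does not extend to the union of the witnesses. A minimal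
  unsatisfiable part of this union is again small, by \<open>card_minimal_unsatisfiable\<close>. This is why
  sparsity is needed up to \<open>card S * m\<close> edges.\<close>

lemma locally_satisfiable_extend:
  fixes E :: "('i \<Rightarrow> 'v) set"
  assumes finE: "finite E" and inj: "\<And>e. e \<in> E \<Longrightarrow> inj_on e J"
    and sparse: "\<And>F. F \<subseteq> E \<Longrightarrow> card F \<le> card S * m \<Longrightarrow>
       26 * card J * card F \<le> 26 * card (\<Union>e\<in>F. e ` J) + 27 * card F"
    and h: "h \<in> locally_satisfiable X m E" "finite (dom h)" "14 * card (dom h) \<le> m"
    and x: "x \<in> X" "x \<notin> dom h"
  shows "\<exists>s\<in>S. h(x \<mapsto> s) \<in> locally_satisfiable X m E"
proof (rule ccontr)
  assume "\<not> ?thesis"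
  then have "\<forall>s\<in>S. \<exists>F\<subseteq>E. card F \<le> m \<and> \<not> satisfiable_from S J P (h(x \<mapsto> s)) F"
    using h x by (auto simp: locally_satisfiable_def)
  then obtain \<F> where \<F>: "\<And>s. s \<in> S \<Longrightarrow> \<F> s \<subseteq> E \<and> card (\<F> s) \<le> m \<and> \<not> satisfiable_from S J P (h(x \<mapsto> s)) (\<F> s)"
    by metis
  define F where "F = (\<Union>s\<in>S. \<F> s)"
  have FE: "F \<subseteq> E" using \<F> by (auto simp: F_def)
  then have finF: "finite F" using finE finite_subset by blast
  have "card F \<le> (\<Sum>s\<in>S. card (\<F> s))" unfolding F_def by (rule card_UN_le[OF finS])
  also have "\<dots> \<le> card S * m" using \<F> sum_bounded_above[of S "\<lambda>s. card (\<F> s)" m] by auto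
  finally have cF: "card F \<le> card S * m" .
  have "satisfiable_from S J P h F"
  proof (rule satisfiable_from_sparse[OF finF h(2)])
    fix F' assume F': "F' \<subseteq> F"
    then show "26 * card J * card F' \<le> 26 * card (\<Union>e\<in>F'. e ` J) + 27 * card F'"
      using FE cF card_mono[OF finF F'] by (intro sparse) auto
    assume "card F' \<le> 14 * card (dom h)"
    then show "satisfiable_from S J P h F'" using h F' FE by (auto simp: locally_satisfiable_def)
  qed (use FE inj in auto)
  then obtain g where g: "range g \<subseteq> S" "\<forall>y\<in>dom h. h y = Some (g y)" "\<forall>e\<in>F. restrict (g \<circ> e) J \<in> P"
    unfolding satisfiable_from_def by auto
  then have s: "g x \<in> S" by auto
  then have "satisfiable_from S J P (h(x \<mapsto> g x)) (\<F> (g x))"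
    using g unfolding satisfiable_from_def F_def by (intro exI[of _ g]) auto
  then show False using \<F>[OF s] by simp
qed

end

section \<open>Edge sets as relational structures\<close>

text \<open>Each edge contributes to every relation its block of coordinates \<open>(R, i)\<close>,
  so one constraint by the product relation is split into one tuple per symbol.\<close>

definition edge_instance :: "'r signature \<Rightarrow> 'v set \<Rightarrow> ('r \<times> nat \<Rightarrow> 'v) set \<Rightarrow> ('r, 'v) rel_structure" where
  "edge_instance \<sigma> X E =
     \<lparr>univ = X, rel = (\<lambda>R. (\<lambda>e. map (\<lambda>i. e (R, i)) [0..<arity \<sigma> R]) ` E)\<rparr>"

lemma product_relation_rel:
  assumes S: "is_structure \<sigma> S" and R: "R \<in> syms \<sigma>"
    and g: "restrict (g \<circ> e) (coords \<sigma>) \<in> product_relation \<sigma> S"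
  shows "map g (map (\<lambda>i. e (R, i)) [0..<arity \<sigma> R]) \<in> rel S R"
proof -
  obtain f where f: "f \<in> (\<Pi>\<^sub>E R\<in>syms \<sigma>. rel S R)"
    "restrict (g \<circ> e) (coords \<sigma>) = restrict (\<lambda>(R, i). f R ! i) (coords \<sigma>)"
    using g unfolding product_relation_def by auto
  have fR: "f R \<in> rel S R" using f R by auto
  then have len: "length (f R) = arity \<sigma> R" using S R by (auto simp: is_structure_def)
  have "g (e (R, i)) = f R ! i" if "i < arity \<sigma> R" for i
    using fun_cong[OF f(2), of "(R, i)"] that R by (simp add: coords_def)
  then have "map g (map (\<lambda>i. e (R, i)) [0..<arity \<sigma> R]) = f R"
    using len by (intro nth_equalityI) auto
  then show ?thesis using fR by simp
qed

lemma product_relation_sub: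
  assumes "is_structure \<sigma> S"
  shows "product_relation \<sigma> S \<subseteq> coords \<sigma> \<rightarrow>\<^sub>E univ S"
proof
  fix p assume "p \<in> product_relation \<sigma> S"
  then obtain f where f: "f \<in> (\<Pi>\<^sub>E R\<in>syms \<sigma>. rel S R)" "p = restrict (\<lambda>(R, i). f R ! i) (coords \<sigma>)"
    unfolding product_relation_def by auto
  have "f R ! i \<in> univ S" if "R \<in> syms \<sigma>" "i < arity \<sigma> R" for R i
  proof -
    have "f R \<in> rel S R" using f that by auto
    then have "length (f R) = arity \<sigma> R" "set (f R) \<subseteq> univ S" using assms that by (auto simp: is_structure_def)
    then show ?thesis using that nth_mem by fastforce
  qed
  then show "p \<in> coords \<sigma> \<rightarrow>\<^sub>E univ S" using f(2) by (auto simp: coords_def)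
qed

text \<open>The strategy consists of the locally satisfiable maps. A tuple inside
  \<open>dom h\<close> comes from a single edge, which is respected because \<open>m\<close> is at
  least 1. Extension works below \<open>k\<close> pebbles because then
  \<open>14 * card (dom h) \<le> m\<close>.\<close>

lemma edge_instance_strategy:
  assumes S: "is_structure \<sigma> S"
    and comp: "composable (coords \<sigma>) (univ S) (product_relation \<sigma> S)"
    and finX: "finite X" and finE: "finite E"
    and E: "\<And>e. e \<in> E \<Longrightarrow> inj_on e (coords \<sigma>)"
    and sparse: "\<And>F. F \<subseteq> E \<Longrightarrow> card F \<le> card (univ S) * m \<Longrightarrow>
       26 * card (coords \<sigma>) * card F \<le> 26 * card (\<Union>e\<in>F. e ` coords \<sigma>) + 27 * card F"
    and m: "14 * k \<le> m" "1 \<le> m"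
  shows "strategy_le \<sigma> k (edge_instance \<sigma> X E) S"
proof -
  interpret composable "coords \<sigma>" "univ S" "product_relation \<sigma> S" by (rule comp)
  let ?sat = "satisfiable_from (univ S) (coords \<sigma>) (product_relation \<sigma> S)"
  let ?I = "edge_instance \<sigma> X E"
  define H where "H = locally_satisfiable X m E"
  have m_le: "m \<le> card (univ S) * m" using S_ne finS by (cases "card (univ S)") auto
  have "strategy \<sigma> k ?I S H"
    unfolding strategy_def
  proof (intro conjI ballI allI impI)
    show "H \<noteq> {}" using empty_locally_satisfiable[OF finE E sparse, of m X] m_le by (auto simp: H_def)
  next
    fix h assume h: "h \<in> H"
    show "partial_hom \<sigma> ?I S h"
      unfolding partial_hom_def homomorphism_def
    proof (intro conjI ballI)
      show "dom h \<subseteq> univ ?I" using h by (simp add: H_def locally_satisfiable_def edge_instance_def)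
      have "?sat h {}" using h by (auto simp: H_def locally_satisfiable_def)
      then obtain g where g: "range g \<subseteq> univ S" "\<forall>y\<in>dom h. h y = Some (g y)"
        by (auto simp: satisfiable_from_def)
      then have "(the \<circ> h) y \<in> univ S" if "y \<in> dom h" for y using that by auto
      then show "the \<circ> h \<in> univ (induced ?I (dom h)) \<rightarrow> univ S"
        unfolding induced_def by (intro funcsetI) simp
    next
      fix R a assume R: "R \<in> syms \<sigma>" and "a \<in> rel (induced ?I (dom h)) R"
      then obtain e where e: "e \<in> E" "a = map (\<lambda>i. e (R, i)) [0..<arity \<sigma> R]" and a: "set a \<subseteq> dom h"
        by (auto simp: induced_def edge_instance_def)
      have "?sat h {e}" using h e m by (auto simp: H_def locally_satisfiable_def)
      then obtain g where g: "\<forall>y\<in>dom h. h y = Some (g y)" "restrict (g \<circ> e) (coords \<sigma>) \<in> product_relation \<sigma> S"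
        by (auto simp: satisfiable_from_def)
      have "h y = Some (g y)" if "y \<in> set a" for y using a g(1) that by blast
      then have "map (the \<circ> h) a = map g a" by simp
      moreover have "map g a \<in> rel S R" using product_relation_rel[OF S R g(2)] unfolding e(2) .
      ultimately show "map (the \<circ> h) a \<in> rel S R" by (simp only:)
    qed
  next
    fix h X' assume "h \<in> H" "X' \<subseteq> dom h"
    then show "h |` X' \<in> H" by (auto simp: H_def locally_satisfiable_def intro: satisfiable_from_restrict)
  next
    fix h x assume h: "h \<in> H" "card (dom h) < k" and x: "x \<in> univ ?I - dom h"
    have "dom h \<subseteq> X" using h by (simp add: H_def locally_satisfiable_def)
    then have fin: "finite (dom h)" using finX finite_subset by blast
    obtain s where s: "h(x \<mapsto> s) \<in> H"
      using locally_satisfiable_extend[OF finE E sparse h(1)[unfolded H_def] fin, of x] h x m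
      by (auto simp: H_def edge_instance_def)
    moreover have "h \<subseteq>\<^sub>m h(x \<mapsto> s)" using x by (auto simp: map_le_def)
    ultimately show "\<exists>f\<in>H. h \<subseteq>\<^sub>m f \<and> dom f = dom h \<union> {x}"
      by (intro bexI[of _ "h(x \<mapsto> s)"]) auto
  qed
  then show ?thesis unfolding strategy_le_def by blast
qed

subsection \<open>Random sparse hypergraphs\<close>

text \<open>The quotient of \<open>b ^ b\<close> by \<open>fact b\<close> is one term of the
  exponential series at \<open>b\<close>.\<close>

lemma power_self_le_exp_fact: "real b ^ b \<le> exp 1 ^ b * fact b"
proof -
  have "(\<Sum>k\<in>{b}. real b ^ k /\<^sub>R fact k) \<le> exp (real b)"
    unfolding exp_def by (rule sum_le_suminf[OF summable_exp_generic]) auto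
  then have "real b ^ b / fact b \<le> exp (real b)" by (simp add: field_simps)
  then show ?thesis using exp_of_nat_mult[of b "1::real"] by (simp add: field_simps)
qed

text \<open>The usual estimate of \<open>a choose b\<close> by the power \<open>b\<close> of
  \<open>exp 1 * a / b\<close>, multiplied out.\<close>

lemma binomial_mult_power_le: "real (a choose b) * real b ^ b \<le> (exp 1 * real a) ^ b"
proof -
  have "real (a choose b) * real b ^ b \<le> real (a choose b) * (exp 1 ^ b * fact b)"
    by (intro mult_left_mono power_self_le_exp_fact) simp
  also have "\<dots> = exp 1 ^ b * real ((a choose b) * fact b)" by simp
  also have "\<dots> \<le> exp 1 ^ b * real (a ^ b)"
    by (intro mult_left_mono of_nat_mono binomial_fact_pow) simp
  finally show ?thesis by (simp add: power_mult_distrib)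
qed

text \<open>Union bound over the \<open>f\<close>-sets of edges and the \<open>v\<close>-sets of vertices that contain them. The
  excess \<open>N f - v \<ge> (1 + 1/26) f\<close> yields the factor \<open>(f / n) ^ (f / 26)\<close> that beats
  all constants once \<open>f / n\<close> is small.\<close>

lemma dense_union_bound:
  fixes N C n f v :: nat and \<zeta> :: real
  assumes pos: "n \<ge> 1" "f \<ge> 1" "N \<ge> 1" and v: "26 * v + 27 * f \<le> 26 * N * f"
    and \<zeta>: "\<zeta> \<le> 1" "exp 1 ^ (N + 1) * C * N * \<zeta> \<le> 1 / 4"
    and small: "N * real f \<le> \<zeta> ^ 26 * n" and \<zeta>0: "\<zeta> \<ge> 0"
  shows "real (C * n choose f) * real (n choose v) * real v ^ (N * f) \<le> (1 / 4) ^ f * real n ^ (N * f)"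
proof -
  define r where "r = N * f - v"
  have vr: "N * f = v + r" "26 * r \<ge> 27 * f" using v by (auto simp: r_def)
  define y where "y = N * real f / n"
  \<comment> \<open>The 26th root gives
    \<open>y ^ r = z ^ (26 * r) \<le> z ^ (27 * f) = (y * z) ^ f\<close>. The extra factor
    \<open>z ^ f\<close> absorbs the constants because \<open>z \<le> \<zeta>\<close>.\<close>
  define z where "z = root 26 y"
  have y0: "y \<ge> 0" by (simp add: y_def)
  have "y \<le> \<zeta> ^ 26" using small pos by (simp add: y_def field_simps)
  then have "z \<le> root 26 (\<zeta> ^ 26)" by (simp add: z_def)
  then have z: "0 \<le> z" "z \<le> \<zeta>" using y0 \<zeta>0 by (auto simp: z_def real_root_power_cancel)
  have zy: "z ^ 26 = y" using y0 by (simp add: z_def)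
  have "y ^ r = z ^ (26 * r)" by (simp add: zy[symmetric] power_mult)
  also have "\<dots> \<le> z ^ (27 * f)" using z \<zeta> vr by (intro power_decreasing) auto
  also have "\<dots> = (y * z) ^ f" by (simp add: zy[symmetric] power_mult power_Suc2[symmetric])
  finally have yr: "y ^ r \<le> (y * z) ^ f" .
  have fq: "((1 / 4) * real f) ^ f = (1 / 4) ^ f * real f ^ f" by (rule power_mult_distrib)
  have vN: "v \<le> N * f" using vr by simp
  then have vN': "real v \<le> real N * real f" by (metis of_nat_le_iff of_nat_mult)
  let ?e = "exp 1 :: real"
  \<comment> \<open>The factor \<open>f ^ f\<close> serves the first binomial and is cancelled at
    the end. The power \<open>v ^ (N * f)\<close> splits into \<open>v ^ v\<close> for the second
    binomial and \<open>v ^ r\<close>.\<close>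
  have "real (C * n choose f) * real (n choose v) * real v ^ (N * f) * real f ^ f
      = (real (C * n choose f) * real f ^ f) * ((real (n choose v) * real v ^ v) * real v ^ r)"
    by (simp add: vr(1) power_add mult_ac)
  also have "\<dots> \<le> (?e * real (C * n)) ^ f * ((?e * real n) ^ v * real (N * f) ^ r)"
    using vN' by (intro mult_mono binomial_mult_power_le power_mono) auto
  also have "\<dots> = (?e * C * n) ^ f * ?e ^ v * (real n ^ v * (N * real f) ^ r)"
    by (simp add: power_mult_distrib mult_ac)
  also have "N * real f = y * n" using pos by (simp add: y_def)
  also have "real n ^ v * (y * n) ^ r = real n ^ (N * f) * y ^ r"
    by (simp add: vr(1) power_add power_mult_distrib)
  also have "(?e * C * n) ^ f * ?e ^ v * (real n ^ (N * f) * y ^ r)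
      \<le> (?e * C * n) ^ f * ?e ^ (N * f) * (real n ^ (N * f) * (y * z) ^ f)"
    using vN yr y0 by (intro mult_mono[OF mult_left_mono mult_left_mono] power_increasing) auto
  also have "\<dots> = (?e ^ (N + 1) * C * (n * y) * z) ^ f * real n ^ (N * f)"
    by (simp add: power_mult_distrib power_mult mult_ac power_add)
  also have "n * y = N * real f" using pos by (simp add: y_def)
  also have "?e ^ (N + 1) * C * (N * real f) * z \<le> (1 / 4) * real f"
  proof -
    have "?e ^ (N + 1) * C * N * z \<le> ?e ^ (N + 1) * C * N * \<zeta>"
      using z by (intro mult_left_mono) auto
    then have "?e ^ (N + 1) * C * N * z \<le> 1 / 4" using \<zeta> by linarith
    then have "real f * (?e ^ (N + 1) * C * N * z) \<le> real f * (1 / 4)" by (intro mult_left_mono) auto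
    then show ?thesis by (simp add: mult_ac)
  qed
  then have "(?e ^ (N + 1) * C * (N * real f) * z) ^ f * real n ^ (N * f)
      \<le> ((1 / 4) * real f) ^ f * real n ^ (N * f)"
    using z by (intro mult_right_mono power_mono) auto
  finally have "real (C * n choose f) * real (n choose v) * real v ^ (N * f) * real f ^ f
     \<le> (1 / 4) ^ f * real n ^ (N * f) * real f ^ f"
    unfolding fq by (simp only: mult_ac)
  then show ?thesis using pos by (auto dest: mult_right_le_imp_le)
qed

lemma card_inj_funcset_ge:
  assumes "finite J" "finite W" "card J \<le> card W"
  shows "(card W - card J) ^ card J \<le> card {e \<in> J \<rightarrow>\<^sub>E W. inj_on e J}"
proof -
  have "(\<Prod>i\<in>{0..<card J}. card W - card J) \<le> (\<Prod>i\<in>{0..<card J}. card W - i)"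
    by (intro prod_mono) auto
  then show ?thesis
    using card_inj_on_subset_funcset[OF assms(1,2) subset_refl] by simp
qed

lemma sum_quarter_powers_le: "(\<Sum>f=1..K. (1 / 4 :: real) ^ f) \<le> 1 / 3"
proof -
  have "(\<Sum>f=1..K. (1 / 4 :: real) ^ f) = (1 - (1 / 4) ^ K) / 3"
  proof (induction K)
    case (Suc K)
    then show ?case by (simp add: Suc)
  qed simp
  then show ?thesis by simp
qed

text \<open>Probability is expressed by counting in \<open>Om\<close>, the sequences of
  \<open>M\<close> maps from \<open>J\<close> to the \<open>n\<close> vertices. Sequences missing
  some \<open>w\<close>-set are at most 2/5 of \<open>Om\<close>, those with a dense small subfamily
  at most 1/3, so a good one remains.\<close>

lemma sparse_hypergraph_exists:
  fixes J :: "'i set" and t :: nat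
  assumes finJ: "finite J" and J2: "card J \<ge> 2" and t: "t \<ge> 1"
  shows "\<exists>\<mu>>0. \<forall>w\<ge>2 * card J. \<exists>E. E \<subseteq> {e \<in> J \<rightarrow>\<^sub>E {..<t * w}. inj_on e J} \<and>
    (\<forall>W\<subseteq>{..<t * w}. card W = w \<longrightarrow> (\<exists>e\<in>E. e ` J \<subseteq> W)) \<and>
    (\<forall>F\<subseteq>E. real (card F) \<le> \<mu> * real (t * w) \<longrightarrow>
       26 * card J * card F \<le> 26 * card (\<Union>e\<in>F. e ` J) + 27 * card F)"
proof -
  define N where "N = card J"
  \<comment> \<open>A random map is injective into a given \<open>w\<close>-set with probability at
    least \<open>1 / (2 * t) ^ N\<close>. So \<open>C * n\<close> maps all fail with probability at
    most \<open>exp (- 2 * n)\<close>, which beats the at most \<open>2 ^ n\<close> choices of the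
    set.\<close>
  define C where "C = 2 * (2 * t) ^ N"
  \<comment> \<open>\<open>\<zeta>\<close> makes the constant in \<open>dense_union_bound\<close>
    equal to 1/4, and \<open>\<mu>\<close> turns its smallness condition into
    \<open>f \<le> \<mu> * n\<close>.\<close>
  define \<zeta> :: real where "\<zeta> = 1 / (4 * (exp 1 ^ (N + 1) * C * N))"
  define \<mu> where "\<mu> = \<zeta> ^ 26 / N"
  have N2: "N \<ge> 2" using J2 by (simp add: N_def)
  have C1: "C \<ge> 1" using t by (simp add: C_def)
  have "exp 1 ^ (N + 1) \<ge> (1::real)" by (intro one_le_power) simp
  then have K1: "exp 1 ^ (N + 1) * C * N \<ge> (1::real)"
    using C1 N2 mult_mono[of 1 "exp 1 ^ (N + 1) :: real" 1 "real C * N"] mult_mono[of 1 "real C" 1 "real N"]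
    by (simp add: mult_ac)
  then have \<zeta>: "0 < \<zeta>" "\<zeta> \<le> 1" "exp 1 ^ (N + 1) * C * N * \<zeta> \<le> 1 / 4"
    unfolding \<zeta>_def by (auto simp: field_simps)
  have \<mu>0: "\<mu> > 0" using \<zeta> N2 by (simp add: \<mu>_def)
  show ?thesis
  proof (intro exI[of _ \<mu>] conjI allI impI \<mu>0)
    fix w assume w: "w \<ge> 2 * card J"
    define n where "n = t * w"
    define M where "M = C * n"
    define Om where "Om = {..<M} \<rightarrow>\<^sub>E (J \<rightarrow>\<^sub>E {..<n})"
    have n1: "n \<ge> 1" using t w J2 by (simp add: n_def)
    have cOm: "card Om = (n ^ N) ^ M" using finJ by (simp add: Om_def card_funcsetE N_def)
    have finOm: "finite Om" unfolding Om_def using finJ by (intro finite_PiE) auto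
    define bad1 where "bad1 = (\<lambda>W. {..<M} \<rightarrow>\<^sub>E ((J \<rightarrow>\<^sub>E {..<n}) - {e \<in> J \<rightarrow>\<^sub>E W. inj_on e J}))"
    define Ws where "Ws = {W. W \<subseteq> {..<n} \<and> card W = w}"
    have b1: "real (card (bad1 W)) \<le> exp (- 2 * real n) * real n ^ (N * M)" if "W \<in> Ws" for W
    proof -
      let ?I = "{e \<in> J \<rightarrow>\<^sub>E W. inj_on e J}"
      have W: "W \<subseteq> {..<n}" "card W = w" "finite W" using that finite_subset by (auto simp: Ws_def)
      define g where "g = card ?I"
      have sub: "?I \<subseteq> J \<rightarrow>\<^sub>E {..<n}" using W by (auto simp: PiE_def)
      have fin: "finite (J \<rightarrow>\<^sub>E {..<n})" using finJ by (intro finite_PiE) auto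
      have "card (bad1 W) = (n ^ N - g) ^ M"
        using finJ sub fin finite_subset[OF sub fin]
        by (simp add: bad1_def card_funcsetE card_Diff_subset N_def g_def)
      moreover have "g \<le> n ^ N"
        using card_mono[OF fin sub] finJ by (simp add: g_def card_funcsetE N_def)
      ultimately have c: "real (card (bad1 W)) = (real n ^ N - g) ^ M" by (simp add: of_nat_diff)
      have "(w - N) ^ N \<le> g" using card_inj_funcset_ge[OF finJ W(3)] W w by (simp add: g_def N_def)
      then have g1: "real (w - N) ^ N \<le> g" by (metis of_nat_le_iff of_nat_power)
      have "real w / 2 \<le> real (w - N)" using w by (simp add: N_def of_nat_diff)
      then have "(real w / 2) ^ N \<le> real (w - N) ^ N" by (intro power_mono) auto
      then have "(real w / 2) ^ N \<le> g" using g1 by (rule order_trans)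
      moreover have "real w / 2 = real n / (2 * t)" using t by (simp add: n_def)
      ultimately have g2: "(real n / (2 * t)) ^ N \<le> g" by simp
      define p where "p = 1 / (2 * real t) ^ N"
      have "g \<ge> p * real n ^ N" using g2 by (simp add: p_def power_divide)
      then have "real n ^ N - g \<le> (1 - p) * real n ^ N" by (simp add: algebra_simps)
      also have "\<dots> \<le> exp (- p) * real n ^ N"
        using exp_ge_add_one_self[of "- p"] by (intro mult_right_mono) auto
      finally have "(real n ^ N - g) ^ M \<le> (exp (- p) * real n ^ N) ^ M"
        using \<open>g \<le> n ^ N\<close> by (intro power_mono) (auto simp flip: of_nat_power)
      also have "\<dots> = exp (- p * M) * real n ^ (N * M)"
        using exp_of_nat2_mult[of "- p" M] by (simp add: power_mult_distrib flip: power_mult)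
      also have "p * M = 2 * real n"
        using t by (simp add: p_def M_def C_def power_mult_distrib field_simps)
      then have "- p * M = - 2 * real n" by simp
      finally show ?thesis using c by simp
    qed
    have cWs: "card Ws \<le> 2 ^ n"
      using card_mono[of "Pow {..<n}" Ws] by (auto simp: Ws_def card_Pow)
    have finWs: "finite Ws" by (simp add: Ws_def)
    have fin1: "finite (\<Union>W\<in>Ws. bad1 W)"
      using finJ finWs by (intro finite_UN_I) (auto simp: bad1_def intro!: finite_PiE)
    have "real (card (\<Union>W\<in>Ws. bad1 W)) \<le> (\<Sum>W\<in>Ws. real (card (bad1 W)))"
      using of_nat_mono[OF card_UN_le[OF finWs, of bad1], where 'a = real] by simp
    also have "\<dots> \<le> (\<Sum>W\<in>Ws. exp (- 2 * real n) * real n ^ (N * M))" by (intro sum_mono b1)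
    also have "\<dots> = card Ws * (exp (- 2 * real n) * real n ^ (N * M))" by simp
    also have "\<dots> \<le> 2 ^ n * (exp (- 2 * real n) * real n ^ (N * M))"
      using of_nat_mono[OF cWs, where 'a = real] by (intro mult_right_mono) auto
    also have "exp (- 2 * real n) = exp (- 2) ^ n"
      using exp_of_nat_mult[of n "- 2 :: real"] by (simp add: mult.commute)
    also have "2 ^ n * (exp (- 2) ^ n * real n ^ (N * M)) = (2 * exp (- 2)) ^ n * real n ^ (N * M)"
      by (simp add: power_mult_distrib)
    also have "\<dots> \<le> (2 / 5) * real n ^ (N * M)"
    proof (rule mult_right_mono)
      have "exp (2::real) \<ge> 5" using exp_lower_Taylor_quadratic[of 2] by simp
      then have e: "2 * exp (- 2) \<le> (2 / 5 :: real)" by (simp add: exp_minus field_simps)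
      then have "(2 * exp (- 2)) ^ n \<le> (2 * exp (- 2) :: real) ^ 1"
        using n1 by (intro power_decreasing) auto
      then show "(2 * exp (- 2)) ^ n \<le> (2 / 5 :: real)" using e by simp
    qed simp
    finally have bound1: "real (card (\<Union>W\<in>Ws. bad1 W)) \<le> 2 / 5 * real n ^ (N * M)" .

    \<comment> \<open>The largest vertex number that \<open>dense_union_bound\<close> admits for
      \<open>f\<close> edges; the subtraction is exact since \<open>N \<ge> 2\<close>.\<close>
    define v where "v = (\<lambda>f. ((26 * N - 27) * f) div 26)"
    have v: "26 * v f + 27 * f \<le> 26 * N * f" for f
    proof -
      have "26 * v f \<le> (26 * N - 27) * f" by (simp add: v_def)
      moreover have "(26 * N - 27) * f + 27 * f = 26 * N * f"
        using N2 by (simp add: add_mult_distrib[symmetric])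
      ultimately show ?thesis by simp
    qed
    define K where "K = nat \<lfloor>\<mu> * n\<rfloor>"
    \<comment> \<open>The maps with index in \<open>A\<close> are confined to \<open>V\<close>, the
      others are free.\<close>
    define bad2 where "bad2 = (\<lambda>(A, V). \<Pi>\<^sub>E i\<in>{..<M}. J \<rightarrow>\<^sub>E (if i \<in> A then V else {..<n}))"
    define AV where "AV = (\<lambda>f. {A. A \<subseteq> {..<M} \<and> card A = f} \<times> {V. V \<subseteq> {..<n} \<and> card V = v f})"
    show "\<exists>E. E \<subseteq> {e \<in> J \<rightarrow>\<^sub>E {..<t * w}. inj_on e J} \<and>
      (\<forall>W\<subseteq>{..<t * w}. card W = w \<longrightarrow> (\<exists>e\<in>E. e ` J \<subseteq> W)) \<and>
      (\<forall>F\<subseteq>E. real (card F) \<le> \<mu> * real (t * w) \<longrightarrow>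
         26 * card J * card F \<le> 26 * card (\<Union>e\<in>F. e ` J) + 27 * card F)"
    proof -
      have b2: "real (card (\<Union>x\<in>AV f. bad2 x)) \<le> (1 / 4) ^ f * real n ^ (N * M)"
        if f: "f \<in> {1..K}" for f
      proof (cases "f \<le> M")
        case True
        have c: "card (bad2 (A, V)) = (v f ^ N) ^ f * (n ^ N) ^ (M - f)"
          if "A \<subseteq> {..<M}" "card A = f" "card V = v f" for A V
        proof -
          have "card (bad2 (A, V)) = (\<Prod>i<M. if i \<in> A then v f ^ N else n ^ N)"
            using finJ that(3) by (auto simp: bad2_def card_PiE N_def card_funcsetE intro!: prod.cong)
          also have "\<dots> = (v f ^ N) ^ card ({..<M} \<inter> A) * (n ^ N) ^ card ({..<M} - A)"
            by (subst prod.If_cases) (auto simp: Diff_eq)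
          also have "{..<M} \<inter> A = A" using that by auto
          also have "card ({..<M} - A) = M - f"
            using that finite_subset[OF that(1)] by (simp add: card_Diff_subset)
          finally show ?thesis using that by simp
        qed
        have "finite (AV f)" by (simp add: AV_def)
        then have "card (\<Union>x\<in>AV f. bad2 x) \<le> (\<Sum>x\<in>AV f. card (bad2 x))" by (rule card_UN_le)
        also have "\<dots> = (\<Sum>x\<in>AV f. (v f ^ N) ^ f * (n ^ N) ^ (M - f))"
          using c by (intro sum.cong) (auto simp: AV_def)
        also have "\<dots> = (M choose f) * (n choose v f) * ((v f ^ N) ^ f * (n ^ N) ^ (M - f))"
          by (simp add: AV_def card_cartesian_product n_subsets)
        finally have "real (card (\<Union>x\<in>AV f. bad2 x))
            \<le> real ((M choose f) * (n choose v f) * ((v f ^ N) ^ f * (n ^ N) ^ (M - f)))"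
          by (rule of_nat_mono)
        also have "\<dots> = real (C * n choose f) * real (n choose v f) * real (v f) ^ (N * f) * real n ^ (N * (M - f))"
          by (simp add: M_def power_mult)
        also have "\<dots> \<le> ((1 / 4) ^ f * real n ^ (N * f)) * real n ^ (N * (M - f))"
        proof (rule mult_right_mono[OF dense_union_bound[OF n1 _ _ v \<zeta>(2,3)]])
          have "real f \<le> \<mu> * n" using f \<mu>0 by (simp add: K_def le_nat_iff le_floor_iff)
          then show "N * real f \<le> \<zeta> ^ 26 * n" using N2 by (simp add: \<mu>_def field_simps)
        qed (use f N2 \<zeta> in auto)
        also have "\<dots> = (1 / 4) ^ f * real n ^ (N * M)"
          using True by (simp add: power_add[symmetric] add_mult_distrib2[symmetric])
        finally show ?thesis .
      next
        case False
        then have "{A. A \<subseteq> {..<M} \<and> card A = f} = {}" using card_mono[of "{..<M}"] by fastforce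
        then have "AV f = {}" unfolding AV_def by simp
        then show ?thesis by simp
      qed
      have finAV: "finite (AV f)" for f by (simp add: AV_def)
      have finbad2: "finite (bad2 x)" if xf: "x \<in> AV f" for x f
      proof -
        obtain A V where x: "x = (A, V)" "V \<subseteq> {..<n}" using xf by (cases x) (auto simp: AV_def)
        then have "finite V" using finite_subset by blast
        then show ?thesis using finJ x by (auto simp: bad2_def intro!: finite_PiE)
      qed
      let ?B2 = "\<Union>f\<in>{1..K}. \<Union>x\<in>AV f. bad2 x"
      have "real (card ?B2) \<le> (\<Sum>f=1..K. real (card (\<Union>x\<in>AV f. bad2 x)))"
        using of_nat_mono[OF card_UN_le[of "{1..K}" "\<lambda>f. \<Union>x\<in>AV f. bad2 x"], where 'a = real] by simp
      also have "\<dots> \<le> (\<Sum>f=1..K. (1 / 4) ^ f * real n ^ (N * M))" by (intro sum_mono b2)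
      also have "\<dots> = (\<Sum>f=1..K. (1 / 4) ^ f) * real n ^ (N * M)" by (simp add: sum_distrib_right)
      also have "\<dots> \<le> 1 / 3 * real n ^ (N * M)" by (intro mult_right_mono sum_quarter_powers_le) simp
      finally have bound2: "real (card ?B2) \<le> 1 / 3 * real n ^ (N * M)" .
      let ?B1 = "\<Union>W\<in>Ws. bad1 W"
      have fin2: "finite ?B2" using finAV finbad2 by blast
      have "\<not> Om \<subseteq> ?B1 \<union> ?B2"
      proof
        assume "Om \<subseteq> ?B1 \<union> ?B2"
        then have "card Om \<le> card (?B1 \<union> ?B2)" by (intro card_mono finite_UnI fin1 fin2)
        also have "\<dots> \<le> card ?B1 + card ?B2" by (rule card_Un_le)
        finally have "real (card Om) \<le> real (card ?B1 + card ?B2)" by (rule of_nat_mono)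
        also have "\<dots> \<le> 2 / 5 * real n ^ (N * M) + 1 / 3 * real n ^ (N * M)" using bound1 bound2 by simp
        also have "\<dots> < real n ^ (N * M)" using n1 by (simp add: field_simps)
        finally show False by (simp add: cOm power_mult)
      qed
      then obtain \<omega> where \<omega>: "\<omega> \<in> Om" "\<omega> \<notin> ?B1" "\<omega> \<notin> ?B2" by blast
      have \<omega>i: "\<omega> i \<in> J \<rightarrow>\<^sub>E {..<n}" if "i < M" for i
        using \<omega>(1) that by (auto simp: Om_def PiE_def)
      \<comment> \<open>Discarding non-injective maps is harmless: \<open>bad1\<close> already
        ignores them, and sparsity passes to subfamilies.\<close>
      define E where "E = {e \<in> \<omega> ` {..<M}. inj_on e J}"
      show ?thesis unfolding n_def[symmetric] N_def[symmetric]
      proof (intro exI[of _ E] conjI allI impI)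
        show "E \<subseteq> {e \<in> J \<rightarrow>\<^sub>E {..<n}. inj_on e J}" using \<omega>i by (auto simp: E_def)
      next
        fix W assume W: "W \<subseteq> {..<n}" "card W = w"
        then have "\<omega> \<notin> bad1 W" using \<omega>(2) by (auto simp: Ws_def)
        moreover have "\<omega> \<in> extensional {..<M}" using \<omega>(1) by (auto simp: Om_def PiE_def)
        ultimately obtain i where i: "i < M" "\<omega> i \<notin> (J \<rightarrow>\<^sub>E {..<n}) - {e \<in> J \<rightarrow>\<^sub>E W. inj_on e J}"
          unfolding bad1_def by (auto simp: PiE_def Pi_def)
        then have "\<omega> i \<in> J \<rightarrow>\<^sub>E W" "inj_on (\<omega> i) J" using \<omega>i by auto
        then show "\<exists>e\<in>E. e ` J \<subseteq> W" using i by (auto simp: E_def intro!: bexI[of _ "\<omega> i"])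
      next
        fix F assume F: "F \<subseteq> E" "real (card F) \<le> \<mu> * real n"
        show "26 * N * card F \<le> 26 * card (\<Union>e\<in>F. e ` J) + 27 * card F"
        proof (rule ccontr)
          assume dense: "\<not> ?thesis"
          define f where "f = card F"
          define V0 where "V0 = (\<Union>e\<in>F. e ` J)"
          have V0: "V0 \<subseteq> {..<n}" using F \<omega>i by (fastforce simp: V0_def E_def PiE_def Pi_def)
          have "f \<noteq> 0"
          proof
            assume "f = 0"
            then have "card F = 0" by (simp only: f_def)
            then show False using dense by (simp only: mult_0_right)
          qed
          moreover have "f \<le> K" using F by (simp add: K_def f_def le_nat_iff le_floor_iff)
          ultimately have f: "f \<in> {1..K}" by simp
          have "26 * card V0 < (26 * N - 27) * f"
            using dense by (simp add: V0_def f_def diff_mult_distrib)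
          then have "card V0 \<le> v f" by (simp add: v_def)
          \<comment> \<open>This allows \<open>V0\<close> to be enlarged to exactly
            \<open>v f\<close> vertices, the size treated in the union bound.\<close>
          moreover have "v f \<le> n"
          proof -
            have "\<zeta> ^ 26 \<le> 1" using \<zeta> by (intro power_le_one) auto
            then have "\<zeta> ^ 26 * n \<le> 1 * real n" by (intro mult_right_mono) auto
            moreover have "N * real f \<le> \<zeta> ^ 26 * n" using F N2 by (simp add: \<mu>_def f_def field_simps)
            ultimately have "real (N * f) \<le> real n" by simp
            then have "N * f \<le> n" by (simp only: of_nat_le_iff)
            then show ?thesis using v[of f] by simp
          qed
          ultimately obtain V where V: "V0 \<subseteq> V" "V \<subseteq> {..<n}" "card V = v f"
            using exists_subset_between[of V0 "v f" "{..<n}"] V0 by auto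
          \<comment> \<open>Choosing one index per edge gives \<open>A\<close> exactly
            \<open>f\<close> elements even if the sequence has repetitions.\<close>
          have "F \<subseteq> \<omega> ` {..<M}" using F by (auto simp: E_def)
          then obtain A where A: "A \<subseteq> {..<M}" "inj_on \<omega> A" "F = \<omega> ` A"
            using subset_image_inj[of F \<omega> "{..<M}"] by auto
          then have "card A = f" by (simp add: f_def card_image)
          then have "(A, V) \<in> AV f" using A V by (simp add: AV_def)
          moreover have "\<omega> \<in> bad2 (A, V)"
          proof -
            have "\<omega> i \<in> J \<rightarrow>\<^sub>E V" if "i \<in> A" for i
            proof -
              have "\<omega> i ` J \<subseteq> V" using A(3) that V(1) unfolding V0_def by blast
              moreover have "i < M" using A(1) that by auto
              ultimately show ?thesis using \<omega>i[of i] by (auto simp: PiE_iff)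
            qed
            then show ?thesis using \<omega>(1) by (simp add: bad2_def Om_def PiE_iff)
          qed
          ultimately show False using \<omega>(3) f by blast
        qed
      qed
    qed
  qed
qed

subsection \<open>Reflexivity\<close>

lemma large_color_class:
  fixes f :: "nat \<Rightarrow> 't" and Y :: "'t set" and w :: nat
  assumes "finite Y" "Y \<noteq> {}" "w \<ge> 1" and f: "f \<in> {..<card Y * w} \<rightarrow> Y"
  obtains a W where "a \<in> Y" "W \<subseteq> {..<card Y * w}" "card W = w" "\<And>x. x \<in> W \<Longrightarrow> f x = a"
proof -
  let ?n = "card Y * w"
  have "\<exists>a\<in>Y. w \<le> card {x\<in>{..<?n}. f x = a}"
  proof (rule ccontr)
    assume "\<not> ?thesis"
    then have less: "card {x\<in>{..<?n}. f x = a} < w" if "a \<in> Y" for a using that by auto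
    have "{..<?n} = (\<Union>a\<in>Y. {x\<in>{..<?n}. f x = a})" using f by auto
    then have "?n = card (\<Union>a\<in>Y. {x\<in>{..<?n}. f x = a})" by (metis card_lessThan)
    also have "\<dots> \<le> (\<Sum>a\<in>Y. card {x\<in>{..<?n}. f x = a})" by (rule card_UN_le[OF assms(1)])
    also have "\<dots> < (\<Sum>a\<in>Y. w)" using assms less by (intro sum_strict_mono) auto
    finally show False by simp
  qed
  then obtain a where a: "a \<in> Y" "w \<le> card {x\<in>{..<?n}. f x = a}" by auto
  then obtain W where "W \<subseteq> {x\<in>{..<?n}. f x = a}" "card W = w"
    using obtain_subset_with_card_n by metis
  then show ?thesis using that[of a W] a by auto
qed

text \<open>At most one symbol has positive arity, and it is unary. So a homomorphism to
  \<open>T\<close> sends one chosen tuple per relation to constant tuples with a common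
  value.\<close>

lemma reflexive_of_few_coords:
  assumes T: "pcsp_template \<sigma> S T" and ne: "\<forall>R\<in>syms \<sigma>. rel S R \<noteq> {}"
    and few: "finite (coords \<sigma>)" "card (coords \<sigma>) < 2"
  shows "reflexive \<sigma> T"
proof -
  obtain f where f: "homomorphism \<sigma> S T f" using T by (auto simp: pcsp_template_def maps_to_def)
  have S: "is_structure \<sigma> S" "is_structure \<sigma> T" using T by (auto simp: pcsp_template_def)
  have "\<exists>x. \<forall>R\<in>syms \<sigma>. x R \<in> rel S R" using ne by (intro bchoice) auto
  then obtain x where x: "\<And>R. R \<in> syms \<sigma> \<Longrightarrow> x R \<in> rel S R" by auto
  have len: "length (x R) = arity \<sigma> R" "set (x R) \<subseteq> univ S" if "R \<in> syms \<sigma>" for R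
    using x[OF that] S that by (auto simp: is_structure_def)
  have "\<exists>a\<in>univ T. \<forall>(R, i)\<in>coords \<sigma>. f (x R ! i) = a"
  proof (cases "coords \<sigma> = {}")
    case True
    then show ?thesis using S by (auto simp: is_structure_def)
  next
    case False
    then obtain R i where Ri: "(R, i) \<in> coords \<sigma>" by auto
    have "coords \<sigma> = {(R, i)}" using few Ri card_le_Suc0_iff_eq[OF few(1)] by auto
    moreover have "f (x R ! i) \<in> univ T"
      using f len[of R] Ri nth_mem[of i "x R"] by (fastforce simp: coords_def homomorphism_def Pi_def)
    ultimately show ?thesis by auto
  qed
  then obtain a where a: "a \<in> univ T" "\<And>R i. R \<in> syms \<sigma> \<Longrightarrow> i < arity \<sigma> R \<Longrightarrow> f (x R ! i) = a"
    by (auto simp: coords_def)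
  have "replicate (arity \<sigma> R) a \<in> rel T R" if R: "R \<in> syms \<sigma>" for R
  proof -
    have "map f (x R) = replicate (arity \<sigma> R) a"
      using a(2)[OF R] len[OF R] by (intro nth_equalityI) auto
    moreover have "map f (x R) \<in> rel T R" using f x[OF R] R unfolding homomorphism_def by blast
    ultimately show ?thesis by (simp only:)
  qed
  then show ?thesis using a by (auto simp: reflexive_def)
qed

text \<open>With \<open>n = t * w\<close> vertices, every map to \<open>T\<close> has a fibre
  containing \<open>w\<close> vertices and hence an edge, whose tuples become constant. The
  parameters are chosen so that the strategy reaches \<open>k n\<close>.\<close>

lemma reflexive_of_sublinear_width:
  assumes fin: "finite (syms \<sigma>)" and tmpl: "pcsp_template \<sigma> S T"
    and ne: "\<forall>R\<in>syms \<sigma>. rel S R \<noteq> {}"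
    and comp: "\<forall>U\<in>structure_projections \<sigma> S. \<forall>V\<in>structure_projections \<sigma> S. U O V = univ S \<times> univ S"
    and width: "sublinear_width \<sigma> S T"
  shows "reflexive \<sigma> T"
proof (cases "card (coords \<sigma>) < 2")
  case True
  then show ?thesis using reflexive_of_few_coords[OF tmpl ne] fin by (simp add: coords_def)
next
  case False
  have S: "is_structure \<sigma> S" and T: "finite (univ T)" "univ T \<noteq> {}"
    using tmpl by (auto simp: pcsp_template_def is_structure_def)
  have finJ: "finite (coords \<sigma>)" using fin by (simp add: coords_def)
  interpret composable "coords \<sigma>" "univ S" "product_relation \<sigma> S"
    using S comp finJ False product_relation_sub[OF S]
    by unfold_locales (auto simp: is_structure_def structure_projections_def)
  obtain k where k: "(\<lambda>n. real (k n)) \<in> o(\<lambda>n. real n)" "has_width \<sigma> S T k"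
    using width by (auto simp: sublinear_width_def)
  define t where "t = card (univ T)"
  define s where "s = card (univ S)"
  have t: "t \<ge> 1" using T by (auto simp: t_def Suc_le_eq card_gt_0_iff)
  have s: "s \<ge> 1" using S_ne finS by (auto simp: s_def Suc_le_eq card_gt_0_iff)
  obtain \<mu> where \<mu>: "\<mu> > 0" and hyp: "\<forall>w\<ge>2 * card (coords \<sigma>).
    \<exists>E. E \<subseteq> {e \<in> coords \<sigma> \<rightarrow>\<^sub>E {..<t * w}. inj_on e (coords \<sigma>)} \<and>
      (\<forall>W\<subseteq>{..<t * w}. card W = w \<longrightarrow> (\<exists>e\<in>E. e ` coords \<sigma> \<subseteq> W)) \<and>
      (\<forall>F\<subseteq>E. real (card F) \<le> \<mu> * real (t * w) \<longrightarrow>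
         26 * card (coords \<sigma>) * card F \<le> 26 * card (\<Union>e\<in>F. e ` coords \<sigma>) + 27 * card F)"
    using sparse_hypergraph_exists[OF finJ J2 t] by (elim exE conjE)
  \<comment> \<open>The factor 28 * \<open>s\<close> combines 14 edges per pebble, a factor
    \<open>s\<close> for the union of witnesses over all values, and a factor 2 for the rounding in
    \<open>m\<close>.\<close>
  have "\<forall>\<^sub>F n in sequentially. norm (real (k n)) \<le> \<mu> / (28 * s) * norm (real n)"
    by (rule landau_o.smallD[OF k(1)]) (use \<mu> s in simp)
  then obtain n0 where n0: "\<And>n. n \<ge> n0 \<Longrightarrow> real (k n) \<le> \<mu> / (28 * s) * real n"
    by (auto simp: eventually_sequentially)
  \<comment> \<open>The first three summands ensure the bound on \<open>k n\<close>, the hypothesis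
    of \<open>hyp\<close>, and \<open>\<mu> * n / (2 * s) \<ge> 1\<close>, which absorbs the
    rounding in \<open>m\<close>.\<close>
  define w where "w = n0 + 2 * card (coords \<sigma>) + nat \<lceil>2 * s / \<mu>\<rceil> + 1"
  define n where "n = t * w"
  have w: "w \<ge> 2 * card (coords \<sigma>)" "w \<ge> 1" by (auto simp: w_def)
  have nw: "n \<ge> w" using t by (simp add: n_def)
  have kn: "real (k n) \<le> \<mu> / (28 * s) * n" using nw by (intro n0) (simp add: w_def)
  have "2 * s / \<mu> \<le> n" using nw of_nat_ceiling[of "2 * s / \<mu>"] by (simp add: w_def)
  then have large: "1 \<le> \<mu> * n / (2 * s)" using \<mu> s by (simp add: field_simps)
  define m where "m = nat \<lfloor>\<mu> * n / s\<rfloor>"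
  have m_le: "real m \<le> \<mu> * n / s" using \<mu> by (simp add: m_def)
  have m_gt: "real m > \<mu> * n / s - 1" unfolding m_def by linarith
  have half: "\<mu> * n / s = 2 * (\<mu> * n / (2 * s))" by simp
  have m1: "1 \<le> m" using m_gt large half by linarith
  have "14 * real (k n) \<le> \<mu> * n / (2 * s)" using kn s by (simp add: field_simps)
  then have m14: "14 * k n \<le> m" using m_gt large half by linarith
  obtain E where E: "E \<subseteq> {e \<in> coords \<sigma> \<rightarrow>\<^sub>E {..<n}. inj_on e (coords \<sigma>)}"
    and hit: "\<forall>W\<subseteq>{..<n}. card W = w \<longrightarrow> (\<exists>e\<in>E. e ` coords \<sigma> \<subseteq> W)"
    and sparse: "\<forall>F\<subseteq>E. real (card F) \<le> \<mu> * real n \<longrightarrow>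
         26 * card (coords \<sigma>) * card F \<le> 26 * card (\<Union>e\<in>F. e ` coords \<sigma>) + 27 * card F"
    using hyp[THEN spec, THEN mp, OF w(1)] unfolding n_def by (elim exE conjE)
  have "finite (coords \<sigma> \<rightarrow>\<^sub>E {..<n})" using finJ by (intro finite_PiE) auto
  moreover have "E \<subseteq> coords \<sigma> \<rightarrow>\<^sub>E {..<n}" using E by auto
  ultimately have finE: "finite E" by (rule finite_subset[rotated])
  let ?I = "edge_instance \<sigma> {..<n} E"
  have "strategy_le \<sigma> (k n) ?I S"
  proof (rule edge_instance_strategy[OF S composable_axioms _ finE _ _ m14 m1])
    fix F assume F: "F \<subseteq> E" "card F \<le> card (univ S) * m"
    have "real (card F) \<le> s * real m" using F(2) unfolding s_def by (metis of_nat_le_iff of_nat_mult)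
    also have "\<dots> \<le> \<mu> * n" using m_le s by (simp add: field_simps)
    finally show "26 * card (coords \<sigma>) * card F \<le> 26 * card (\<Union>e\<in>F. e ` coords \<sigma>) + 27 * card F"
      using sparse F by blast
  qed (use E in auto)
  moreover have "is_structure \<sigma> ?I"
  proof -
    have "e (R, i) < n" if "e \<in> E" "R \<in> syms \<sigma>" "i < arity \<sigma> R" for e R i
    proof -
      have "e \<in> coords \<sigma> \<rightarrow>\<^sub>E {..<n}" "(R, i) \<in> coords \<sigma>" using E that by (auto simp: coords_def)
      then show ?thesis by blast
    qed
    moreover have "n > 0" using nw w by simp
    ultimately show ?thesis by (auto simp: is_structure_def edge_instance_def)
  qed
  ultimately have "maps_to \<sigma> ?I T"
    using k(2) unfolding has_width_def by (simp add: edge_instance_def)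
  then obtain f where f: "homomorphism \<sigma> ?I T f" by (auto simp: maps_to_def)
  then have "f \<in> {..<card (univ T) * w} \<rightarrow> univ T"
    by (simp add: homomorphism_def edge_instance_def n_def t_def)
  then obtain a W where a: "a \<in> univ T" and W: "W \<subseteq> {..<n}" "card W = w" "\<And>x. x \<in> W \<Longrightarrow> f x = a"
    using large_color_class[OF T w(2)] unfolding n_def t_def by metis
  obtain e where e: "e \<in> E" "e ` coords \<sigma> \<subseteq> W" using hit W by blast
  have "replicate (arity \<sigma> R) a \<in> rel T R" if R: "R \<in> syms \<sigma>" for R
  proof -
    have "f (e (R, i)) = a" if "i < arity \<sigma> R" for i
      using W(3) e(2) R that by (auto simp: coords_def)
    then have "map f (map (\<lambda>i. e (R, i)) [0..<arity \<sigma> R]) = replicate (arity \<sigma> R) a"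
      by (intro nth_equalityI) auto
    moreover have "map (\<lambda>i. e (R, i)) [0..<arity \<sigma> R] \<in> rel ?I R" using e by (auto simp: edge_instance_def)
    then have "map f (map (\<lambda>i. e (R, i)) [0..<arity \<sigma> R]) \<in> rel T R"
      using f R unfolding homomorphism_def by blast
    ultimately show ?thesis by (simp only:)
  qed
  then show ?thesis using a by (auto simp: reflexive_def)
qed

lemma sublinear_of_bounded_width:
  assumes "bounded_width \<sigma> S T"
  shows "sublinear_width \<sigma> S T"
proof -
  obtain k where k: "(\<lambda>n. real (k n)) \<in> O(\<lambda>n. 1)" "has_width \<sigma> S T k"
    using assms by (auto simp: bounded_width_def)
  have "(\<lambda>n. 1 :: real) \<in> o(\<lambda>n. real n)"
    by (rule smalloI_tendsto) (auto intro: lim_1_over_n eventually_gt_at_top elim!: eventually_mono[OF eventually_gt_at_top[of 0]])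
  with k(1) have "(\<lambda>n. real (k n)) \<in> o(\<lambda>n. real n)" by (rule landau_o.big_small_trans)
  then show ?thesis using k(2) by (auto simp: sublinear_width_def)
qed

theorem theorem4p1:
  fixes \<sigma> :: "'r signature"
    and S :: "('r, 's) rel_structure"
    and T :: "('r, 't) rel_structure"
  assumes "finite (syms \<sigma>)"
    and "pcsp_template \<sigma> S T"
    and "\<forall>R\<in>syms \<sigma>. rel S R \<noteq> {}"
    and "\<forall>U\<in>structure_projections \<sigma> S. \<forall>V\<in>structure_projections \<sigma> S.
           U O V = univ S \<times> univ S"
  shows "(sublinear_width \<sigma> S T \<longrightarrow> reflexive \<sigma> T) \<and>
         (bounded_width \<sigma> S T \<longrightarrow> reflexive \<sigma> T)"
  using reflexive_of_sublinear_width[OF assms] sublinear_of_bounded_width by blast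

end
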